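(* Let $k\ge 2$ be an integer and let $\rho:F_2\to\mathrm{GL}(n,\mathbb{C})$ be an oriented characteristic representation with $P_k\subset\ker\rho$. Let $\mathcal{I}\subset\mathcal{A}_k/\!\sim$ be a linear subspace that is invariant under $N^\sim_{M,\psi}$ for all $(M,\psi)\in\Delta$. Let $m=\dim\mathcal{I}$ and choose $\hat\rho_1,\dots,\hat\rho_m\in\mathcal{A}_k$ whose images in $\mathcal{A}_k/\!\sim$ form a basis of $\mathcal{I}$. Define $$\tilde\rho:F_2\to\mathrm{GL}(n+m,\mathbb{C}),\qquad \tilde\rho(g)=\begin{pmatrix}\rho(g)&Q(g)\\0&I\end{pmatrix},$$ where $Q(g)$ is the $n\times m$ matrix whose $i$-th column is $\pi_1(\hat\rho_i(g))$. Then $\tilde\rho$ is also an oriented characteristic representation (in particular a homomorphism) with $P_k\subset\ker\tilde\rho$. Furthermore, there is a short exact sequence of the form $$1\to\tilde\rho(\ker\rho)\to F_2/\ker\tilde\rho\to F_2/\ker\rho\to 1,$$ and $\tilde\rho(\ker\rho)$ is a torsion-free abelian group.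
   Context: $F_2=\langle a,b\rangle$ is the free group on $a,b$; an element is primitive if it belongs to some two-element generating set of $F_2$; $P_k\subset F_2$ is the subgroup generated by the $k$-th powers of all primitive elements (it is characteristic). $\mathrm{Aut}_+(F_2)$ is the subgroup of automorphisms preserving the conjugacy class of $[a,b]$ and $\mathrm{Aut}_-(F_2)=\mathrm{Aut}(F_2)\smallsetminus\mathrm{Aut}_+(F_2)$ (whose elements send the class of $[a,b]$ to that of $[b,a]$). A homomorphism $\rho:F_2\to\mathrm{GL}(n,\mathbb{C})$ is an oriented characteristic representation if: (+) for each $\psi\in\mathrm{Aut}_+(F_2)$ there is $M\in\mathrm{GL}(n,\mathbb{C})$ with $M\rho(\psi^{-1}(g))M^{-1}=\rho(g)$ for all $g\in F_2$; and (--) for each $\psi\in\mathrm{Aut}_-(F_2)$ there is $M\in\mathrm{GL}(n,\mathbb{C})$ with $M\overline{\rho(\psi^{-1}(g))}M^{-1}=\rho(g)$ for all $g\in F_2$ (bar = entrywise complex conjugation). Let $\Delta_+$ (resp. $\Delta_-$) be the set of all pairs $(M,\psi)\in\mathrm{GL}(n,\mathbb{C})\times\mathrm{Aut}_+(F_2)$ (resp. $\mathrm{GL}(n,\mathbb{C})\times\mathrm{Aut}_-(F_2)$) satisfying the corresponding identity, and $\Delta=\Delta_+\sqcup\Delta_-$. $\mathrm{Aff}(n)=\mathbb{C}^n\rtimes\mathrm{GL}(n,\mathbb{C})$ with product $(\mathbf{v},M)(\mathbf{w},N)=(\mathbf{v}+M\mathbf{w},MN)$; $\pi_1:\mathrm{Aff}(n)\to\mathbb{C}^n$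 and $\pi_2:\mathrm{Aff}(n)\to\mathrm{GL}(n,\mathbb{C})$ are the projections, and $\mathrm{GL}(n,\mathbb{C})$ is viewed as a subgroup via $M\mapsto(\mathbf{0},M)$. For fixed $\rho$, $\mathcal{A}$ is the set of all homomorphisms $\hat\rho:F_2\to\mathrm{Aff}(n)$ with $\pi_2\circ\hat\rho=\rho$. It is a complex vector space under addition and scalar multiplication of the $\pi_1$-components: $(\hat\rho_1+\hat\rho_2)(g)=(\pi_1\hat\rho_1(g)+\pi_1\hat\rho_2(g),\rho(g))$, $(\lambda\hat\rho_1)(g)=(\lambda\pi_1\hat\rho_1(g),\rho(g))$. For $\hat\rho_1,\hat\rho_2\in\mathcal{A}$ write $\hat\rho_1\sim\hat\rho_2$ if there is $\mathbf{v}\in\mathbb{C}^n$ with $\hat\rho_2(g)=(\mathbf{v},I)\hat\rho_1(g)(-\mathbf{v},I)$ for all $g\in F_2$; then $\mathcal{A}/\!\sim$ is a quotient vector space of $\mathcal{A}$. $\mathcal{A}_k=\{\hat\rho\in\mathcal{A}: P_k\subset\ker\hat\rho\}$ is a linear subspace of $\mathcal{A}$ which is a union of $\sim$-classes, so $\mathcal{A}_k/\!\sim$ is a linear subspace of $\mathcal{A}/\!\sim$. For $(M,\psi)\in\Delta_+$ let $N_{M,\psi}:\mathcal{A}\to\mathcal{A}$ be $N_{M,\psi}(\hat\rho)(g)=M\cdot\hat\rho(\psi^{-1}(g))\cdot M^{-1}$; for $(M,\psi)\in\Delta_-$ let $N_{M,\psi}(\hat\rho)(g)=M\cdot\overline{\hat\rho(\psi^{-1}(g))}\cdot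 M^{-1}$ (products in $\mathrm{Aff}(n)$). These are linear (resp. conjugate-linear) automorphisms of $\mathcal{A}$ that respect $\sim$ and preserve $\mathcal{A}_k$; $N^\sim_{M,\psi}$ denotes the induced map on $\mathcal{A}/\!\sim$. *)

theory Defs
  imports
    "HOL-Algebra.Bij"
    "HOL-Algebra.Coset"
    "HOL-Algebra.Generated_Groups"
    "Jordan_Normal_Form.VS_Connect"
begin

section \<open>The free group on two generators\<close>

datatype gen = Gen_a | Gen_b

text \<open>A letter is a generator with an exponent sign: \<open>(x, True)\<close> stands for \<open>x\<close> and
  \<open>(x, False)\<close> for its inverse. Words are taken modulo insertion and deletion of cancelling pairs.\<close>

type_synonym word = "(gen \<times> bool) list"

inductive word_eq :: "word \<Rightarrow> word \<Rightarrow> bool" where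
  cancel: "word_eq (u @ [(x, e), (x, \<not> e)] @ v) (u @ v)"
| refl: "word_eq u u"
| sym: "word_eq u v \<Longrightarrow> word_eq v u"
| trans: "word_eq u v \<Longrightarrow> word_eq v w \<Longrightarrow> word_eq u w"

lemma equivp_word_eq: "equivp word_eq"
  by (intro equivpI reflpI sympI transpI) (auto intro: word_eq.intros)

quotient_type f2 = word / word_eq
  by (rule equivp_word_eq)

lemma word_eq_append_right: "word_eq u v \<Longrightarrow> word_eq (u @ w) (v @ w)"
proof (induction rule: word_eq.induct)
  case (cancel u x e v)
  show ?case using word_eq.cancel[of u x e "v @ w"] by simp
qed (auto intro: word_eq.intros)

lemma word_eq_append_left: "word_eq u v \<Longrightarrow> word_eq (w @ u) (w @ v)"
proof (induction rule: word_eq.induct)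
  case (cancel u x e v)
  show ?case using word_eq.cancel[of "w @ u" x e v] by simp
qed (auto intro: word_eq.intros)

lift_definition f2_mult :: "f2 \<Rightarrow> f2 \<Rightarrow> f2" is append
  by (blast intro: word_eq.trans word_eq_append_left word_eq_append_right)

lift_definition f2_one :: f2 is "[]" .

lift_definition f2_gen :: "gen \<Rightarrow> f2" is "\<lambda>x. [(x, True)]" .

definition F2 :: "f2 monoid" where
  "F2 = \<lparr>carrier = UNIV, mult = f2_mult, one = f2_one\<rparr>"

lemma word_eq_inverse: "word_eq (rev (map (\<lambda>(x, e). (x, \<not> e)) w) @ w) []"
proof (induction w)
  case (Cons l w)
  obtain x e where l: "l = (x, e)" by (cases l)
  let ?r = "rev (map (\<lambda>(x, e). (x, \<not> e)) w)"
  have "word_eq (?r @ [(x, \<not> e), (x, \<not> \<not> e)] @ w) (?r @ w)" by (rule word_eq.cancel)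
  with Cons.IH show ?case by (auto simp: l intro: word_eq.trans)
qed (simp add: word_eq.refl)

lemma group_F2: "group F2"
proof (rule groupI)
  fix x y z :: f2
  show "x \<otimes>\<^bsub>F2\<^esub> y \<otimes>\<^bsub>F2\<^esub> z = x \<otimes>\<^bsub>F2\<^esub> (y \<otimes>\<^bsub>F2\<^esub> z)"
    unfolding F2_def by simp (transfer, simp add: word_eq.refl)
  show "\<one>\<^bsub>F2\<^esub> \<otimes>\<^bsub>F2\<^esub> x = x"
    unfolding F2_def by simp (transfer, simp add: word_eq.refl)
  have "\<exists>y. f2_mult y x = f2_one" by transfer (blast intro: word_eq_inverse)
  then show "\<exists>y\<in>carrier F2. y \<otimes>\<^bsub>F2\<^esub> x = \<one>\<^bsub>F2\<^esub>" by (simp add: F2_def)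
qed (simp_all add: F2_def)

definition primitive :: "f2 \<Rightarrow> bool" where
  "primitive g \<longleftrightarrow>
     (\<exists>S \<subseteq> carrier F2. card S = 2 \<and> g \<in> S \<and> generate F2 S = carrier F2)"

definition power_subgroup :: "nat \<Rightarrow> f2 set" where
  "power_subgroup k = generate F2 {g [^]\<^bsub>F2\<^esub> k | g. primitive g}"

definition conj_class :: "('a, 'b) monoid_scheme \<Rightarrow> 'a \<Rightarrow> 'a set" where
  "conj_class G g = {x \<otimes>\<^bsub>G\<^esub> g \<otimes>\<^bsub>G\<^esub> inv\<^bsub>G\<^esub> x | x. x \<in> carrier G}"

definition comm_ab :: f2 where
  "comm_ab = f2_gen Gen_a \<otimes>\<^bsub>F2\<^esub> f2_gen Gen_b \<otimes>\<^bsub>F2\<^esub>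
     inv\<^bsub>F2\<^esub> (f2_gen Gen_a) \<otimes>\<^bsub>F2\<^esub> inv\<^bsub>F2\<^esub> (f2_gen Gen_b)"

definition Aut_plus :: "(f2 \<Rightarrow> f2) set" where
  "Aut_plus = {\<psi> \<in> auto F2. \<psi> ` conj_class F2 comm_ab = conj_class F2 comm_ab}"

definition Aut_minus :: "(f2 \<Rightarrow> f2) set" where
  "Aut_minus = auto F2 - Aut_plus"

section \<open>Oriented characteristic representations\<close>

definition GL :: "nat \<Rightarrow> complex mat monoid" where
  "GL n = units_of (ring_mat TYPE(complex) n ())"

definition Delta_plus :: "nat \<Rightarrow> (f2 \<Rightarrow> complex mat) \<Rightarrow> (complex mat \<times> (f2 \<Rightarrow> f2)) set" where
  "Delta_plus n \<rho> = {(M, \<psi>). M \<in> carrier (GL n) \<and> \<psi> \<in> Aut_plus \<and>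
     (\<forall>g \<in> carrier F2.
        M \<otimes>\<^bsub>GL n\<^esub> \<rho> (inv_into (carrier F2) \<psi> g) \<otimes>\<^bsub>GL n\<^esub> inv\<^bsub>GL n\<^esub> M = \<rho> g)}"

definition Delta_minus :: "nat \<Rightarrow> (f2 \<Rightarrow> complex mat) \<Rightarrow> (complex mat \<times> (f2 \<Rightarrow> f2)) set" where
  "Delta_minus n \<rho> = {(M, \<psi>). M \<in> carrier (GL n) \<and> \<psi> \<in> Aut_minus \<and>
     (\<forall>g \<in> carrier F2.
        M \<otimes>\<^bsub>GL n\<^esub> map_mat cnj (\<rho> (inv_into (carrier F2) \<psi> g)) \<otimes>\<^bsub>GL n\<^esub> inv\<^bsub>GL n\<^esub> M = \<rho> g)}"

definition oriented_char_rep :: "nat \<Rightarrow> (f2 \<Rightarrow> complex mat) \<Rightarrow> bool" where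
  "oriented_char_rep n \<rho> \<longleftrightarrow> \<rho> \<in> hom F2 (GL n) \<and>
     (\<forall>\<psi> \<in> Aut_plus. \<exists>M. (M, \<psi>) \<in> Delta_plus n \<rho>) \<and>
     (\<forall>\<psi> \<in> Aut_minus. \<exists>M. (M, \<psi>) \<in> Delta_minus n \<rho>)"

section \<open>Affine lifts\<close>

type_synonym aff = "complex vec \<times> complex mat"

definition Aff :: "nat \<Rightarrow> aff monoid" where
  "Aff n = \<lparr>carrier = carrier_vec n \<times> carrier (GL n),
            mult = (\<lambda>(v, M) (w, N). (v + M *\<^sub>v w, M * N)),
            one = (0\<^sub>v n, 1\<^sub>m n)\<rparr>"

definition aff_linear :: "nat \<Rightarrow> complex mat \<Rightarrow> aff" where
  "aff_linear n M = (0\<^sub>v n, M)"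

definition aff_cnj :: "aff \<Rightarrow> aff" where
  "aff_cnj = (\<lambda>(v, M). (map_vec cnj v, map_mat cnj M))"

definition lifts :: "nat \<Rightarrow> (f2 \<Rightarrow> complex mat) \<Rightarrow> (f2 \<Rightarrow> aff) set" where
  "lifts n \<rho> = {\<sigma> \<in> hom F2 (Aff n). \<forall>g \<in> carrier F2. snd (\<sigma> g) = \<rho> g}"

text \<open>As usual for \<open>module\<close> records of vector spaces, the multiplicative fields of the
  underlying ring record play no role.\<close>

definition lift_space :: "nat \<Rightarrow> (f2 \<Rightarrow> complex mat) \<Rightarrow> (complex, f2 \<Rightarrow> aff) module" where
  "lift_space n \<rho> = \<lparr>carrier = lifts n \<rho>, mult = undefined, one = undefined,
     zero = (\<lambda>g. (0\<^sub>v n, \<rho> g)),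
     add = (\<lambda>\<sigma> \<tau> g. (fst (\<sigma> g) + fst (\<tau> g), \<rho> g)),
     smult = (\<lambda>c \<sigma> g. (c \<cdot>\<^sub>v fst (\<sigma> g), \<rho> g))\<rparr>"

definition lift_rel :: "nat \<Rightarrow> (f2 \<Rightarrow> complex mat) \<Rightarrow> ((f2 \<Rightarrow> aff) \<times> (f2 \<Rightarrow> aff)) set" where
  "lift_rel n \<rho> = {(\<sigma>, \<tau>). \<sigma> \<in> lifts n \<rho> \<and> \<tau> \<in> lifts n \<rho> \<and>
     (\<exists>v \<in> carrier_vec n. \<forall>g \<in> carrier F2.
        \<tau> g = (v, 1\<^sub>m n) \<otimes>\<^bsub>Aff n\<^esub> \<sigma> g \<otimes>\<^bsub>Aff n\<^esub> (- v, 1\<^sub>m n))}"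

definition lift_class :: "nat \<Rightarrow> (f2 \<Rightarrow> complex mat) \<Rightarrow> (f2 \<Rightarrow> aff) \<Rightarrow> (f2 \<Rightarrow> aff) set" where
  "lift_class n \<rho> \<sigma> = lift_rel n \<rho> `` {\<sigma>}"

text \<open>Operations on classes are given as the union of the classes of all results on
  representatives; this is a single class because the operations respect the relation.\<close>

definition lift_quotient ::
    "nat \<Rightarrow> (f2 \<Rightarrow> complex mat) \<Rightarrow> (complex, (f2 \<Rightarrow> aff) set) module" where
  "lift_quotient n \<rho> = \<lparr>carrier = lifts n \<rho> // lift_rel n \<rho>, mult = undefined, one = undefined,
     zero = lift_class n \<rho> \<zero>\<^bsub>lift_space n \<rho>\<^esub>,
     add = (\<lambda>X Y. \<Union>\<sigma>\<in>X. \<Union>\<tau>\<in>Y. lift_class n \<rho> (\<sigma> \<oplus>\<^bsub>lift_space n \<rho>\<^esub> \<tau>)),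
     smult = (\<lambda>c X. \<Union>\<sigma>\<in>X. lift_class n \<rho> (c \<odot>\<^bsub>lift_space n \<rho>\<^esub> \<sigma>))\<rparr>"

definition lifts_k :: "nat \<Rightarrow> nat \<Rightarrow> (f2 \<Rightarrow> complex mat) \<Rightarrow> (f2 \<Rightarrow> aff) set" where
  "lifts_k k n \<rho> = {\<sigma> \<in> lifts n \<rho>. power_subgroup k \<subseteq> kernel F2 (Aff n) \<sigma>}"

definition lift_quotient_k ::
    "nat \<Rightarrow> nat \<Rightarrow> (f2 \<Rightarrow> complex mat) \<Rightarrow> (complex, (f2 \<Rightarrow> aff) set) module" where
  "lift_quotient_k k n \<rho> = (lift_quotient n \<rho>)\<lparr>carrier := lifts_k k n \<rho> // lift_rel n \<rho>\<rparr>"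

definition N_plus ::
    "nat \<Rightarrow> complex mat \<Rightarrow> (f2 \<Rightarrow> f2) \<Rightarrow> (f2 \<Rightarrow> aff) \<Rightarrow> (f2 \<Rightarrow> aff)" where
  "N_plus n M \<psi> \<sigma> = (\<lambda>g. aff_linear n M \<otimes>\<^bsub>Aff n\<^esub> \<sigma> (inv_into (carrier F2) \<psi> g)
     \<otimes>\<^bsub>Aff n\<^esub> aff_linear n (inv\<^bsub>GL n\<^esub> M))"

definition N_minus ::
    "nat \<Rightarrow> complex mat \<Rightarrow> (f2 \<Rightarrow> f2) \<Rightarrow> (f2 \<Rightarrow> aff) \<Rightarrow> (f2 \<Rightarrow> aff)" where
  "N_minus n M \<psi> \<sigma> = (\<lambda>g. aff_linear n M \<otimes>\<^bsub>Aff n\<^esub> aff_cnj (\<sigma> (inv_into (carrier F2) \<psi> g))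
     \<otimes>\<^bsub>Aff n\<^esub> aff_linear n (inv\<^bsub>GL n\<^esub> M))"

definition induced :: "nat \<Rightarrow> (f2 \<Rightarrow> complex mat) \<Rightarrow>
    ((f2 \<Rightarrow> aff) \<Rightarrow> (f2 \<Rightarrow> aff)) \<Rightarrow> (f2 \<Rightarrow> aff) set \<Rightarrow> (f2 \<Rightarrow> aff) set" where
  "induced n \<rho> T X = (\<Union>\<sigma>\<in>X. lift_class n \<rho> (T \<sigma>))"

definition Delta_invariant ::
    "nat \<Rightarrow> (f2 \<Rightarrow> complex mat) \<Rightarrow> (f2 \<Rightarrow> aff) set set \<Rightarrow> bool" where
  "Delta_invariant n \<rho> W \<longleftrightarrow>
     (\<forall>(M, \<psi>) \<in> Delta_plus n \<rho>. induced n \<rho> (N_plus n M \<psi>) ` W \<subseteq> W) \<and>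
     (\<forall>(M, \<psi>) \<in> Delta_minus n \<rho>. induced n \<rho> (N_minus n M \<psi>) ` W \<subseteq> W)"

section \<open>The extended representation\<close>

text \<open>The \<open>m\<close> chosen lifts are indexed by \<open>0, \<dots>, m - 1\<close>.\<close>

definition extended_rep ::
    "nat \<Rightarrow> nat \<Rightarrow> (f2 \<Rightarrow> complex mat) \<Rightarrow> (nat \<Rightarrow> f2 \<Rightarrow> aff) \<Rightarrow> f2 \<Rightarrow> complex mat" where
  "extended_rep n m \<rho> \<sigma> g = four_block_mat
     (\<rho> g)       (mat_of_cols n (map (\<lambda>i. fst (\<sigma> i g)) [0..<m]))
     (0\<^sub>m m n)    (1\<^sub>m m)"

text \<open>The library's \<open>exact_seq\<close> forces all groups to have the same element type.\<close>

definition short_exact_seq :: "('a, 'x) monoid_scheme \<Rightarrow> ('a \<Rightarrow> 'b) \<Rightarrow>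
    ('b, 'y) monoid_scheme \<Rightarrow> ('b \<Rightarrow> 'c) \<Rightarrow> ('c, 'z) monoid_scheme \<Rightarrow> bool" where
  "short_exact_seq A f B g C \<longleftrightarrow>
     group_hom A B f \<and> group_hom B C g \<and> inj_on f (carrier A) \<and>
     f ` carrier A = kernel B C g \<and> g ` carrier B = carrier C"

definition torsion_free :: "('a, 'b) monoid_scheme \<Rightarrow> bool" where
  "torsion_free G \<longleftrightarrow>
     (\<forall>x \<in> carrier G. \<forall>j::nat. 0 < j \<longrightarrow> x [^]\<^bsub>G\<^esub> j = \<one>\<^bsub>G\<^esub> \<longrightarrow> x = \<one>\<^bsub>G\<^esub>)"

end

theory Submission
  imports Defs
begin

text \<open>Write \<open>u\<^sub>i\<close> for the translation part of the \<open>i\<close>-th lift. It is a crossed homomorphism for \<open>\<rho>\<close>, and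
  this is what makes the block upper triangular map \<open>extended_rep\<close> multiplicative. Conjugating a lift
  by a translation by \<open>v\<close> adds the coboundary \<open>v - \<rho> g v\<close> to its translation part
  (\<open>lift_rel_iff\<close>), so the quotient by \<open>lift_rel\<close> is a first cohomology group and the chosen lifts
  give a basis of an invariant subspace of it.

  For \<open>(M, \<psi>)\<close> in \<open>Delta_plus\<close>, invariance says that the twist of the \<open>j\<close>-th lift is a linear
  combination of the lifts, with coefficients \<open>C\<^sub>i\<^sub>j\<close>, plus a coboundary given by a vector \<open>V\<^sub>j\<close>.
  In matrix form this is \<open>M Q(\<psi>\<inverse> g) = Q(g) C + V - \<rho>(g) V\<close>, which together with
  \<open>M \<rho>(\<psi>\<inverse> g) = \<rho>(g) M\<close> states that the block matrix \<open>(M, -V; 0, C)\<close> intertwines the twist of the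
  extended representation with the extended representation itself. The matrix \<open>C\<close> is invertible
  because the lifts are linearly independent modulo coboundaries (\<open>block_intertwiner\<close>). For \<open>Delta_minus\<close> the same
  argument applies with complex conjugation inserted, so both cases are treated at once by means of
  an involutive field automorphism \<open>f\<close> of the complex numbers (\<open>extended_rep_twisted\<close>).

  An element lies in the kernel of the extended representation if and only if \<open>\<rho>\<close> and all \<open>u\<^sub>i\<close>
  are trivial on it. Hence this kernel contains \<open>power_subgroup k\<close> and is contained in
  \<open>ker \<rho>\<close>, and the exact sequence is the third isomorphism theorem (\<open>short_exact_seq_image_Mod_kernel\<close>). Finally, on
  \<open>ker \<rho>\<close> the extended representation takes values in the unipotent matrices \<open>(1, Q; 0, 1)\<close>, a
  copy of the torsion-free abelian group of complex \<open>n \<times> m\<close> matrices under addition.\<close>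

section \<open>Quotients by nested kernels\<close>

lemma (in group_hom) fibre_eq_coset:
  assumes "x \<in> carrier G"
  shows "{y \<in> carrier G. h y = h x} = kernel G H h #> x"
proof (intro equalityI subsetI)
  fix y assume y: "y \<in> {y \<in> carrier G. h y = h x}"
  then have "y \<otimes> inv x \<in> kernel G H h"
    using assms by (simp add: kernel_def)
  moreover have "y = (y \<otimes> inv x) \<otimes> x"
    using y assms by (simp add: G.m_assoc)
  ultimately show "y \<in> kernel G H h #> x"
    unfolding r_coset_def by blast
next
  fix y assume "y \<in> kernel G H h #> x"
  then show "y \<in> {y \<in> carrier G. h y = h x}"
    using assms by (auto simp: r_coset_def kernel_def)
qed

text \<open>This is the third isomorphism theorem \<open>(G / ker h) / (N / ker h) \<cong> G / N\<close>, with \<open>N / ker h\<close>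
  replaced by the isomorphic group \<open>h ` N\<close>. The inclusion sends an element of \<open>h ` N\<close> to its fibre,
  which is a coset of \<open>ker h\<close>.\<close>

lemma (in group_hom) short_exact_seq_image_Mod_kernel:
  assumes N: "N \<lhd> G" and le: "kernel G H h \<subseteq> N"
  shows "\<exists>\<iota> \<pi>. short_exact_seq (H\<lparr>carrier := h ` N\<rparr>) \<iota> (G Mod kernel G H h) \<pi> (G Mod N)"
proof -
  let ?K = "kernel G H h"
  interpret N: normal N G by (rule N)
  interpret K: normal ?K G by (rule normal_kernel)
  interpret QN: Group.group "G Mod N" by (rule N.factorgroup_is_group)
  interpret QK: Group.group "G Mod ?K" by (rule K.factorgroup_is_group)
  have quot: "group_hom G (G Mod N) (\<lambda>x. N #> x)"
    using N.r_coset_hom_Mod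
    by (intro group_hom.intro group_hom_axioms.intro G.group_axioms QN.group_axioms)
  have coset_N: "N #> x = N \<longleftrightarrow> x \<in> N" if "x \<in> carrier G" for x
    using that N.rcos_const[OF G.group_axioms] G.coset_join1[OF _ that N.subgroup_axioms]
    by metis
  have "?K \<subseteq> kernel G (G Mod N) (\<lambda>x. N #> x)"
  proof
    fix x assume x: "x \<in> ?K"
    then have "x \<in> carrier G" and "x \<in> N"
      using le K.subset by auto
    then show "x \<in> kernel G (G Mod N) (\<lambda>x. N #> x)"
      unfolding kernel_def one_FactGroup using coset_N by blast
  qed
  then obtain \<pi> where \<pi>_hom: "\<pi> \<in> hom (G Mod ?K) (G Mod N)"
    and \<pi>: "\<And>x. x \<in> carrier G \<Longrightarrow> \<pi> (?K #> x) = N #> x"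
    by (rule group_hom.FactGroup_universal_kernel[OF quot normal_kernel]) (rule that)
  define \<iota> where "\<iota> y = {x \<in> carrier G. h x = y}" for y
  have \<iota>: "\<iota> (h x) = ?K #> x" if "x \<in> carrier G" for x
    unfolding \<iota>_def by (rule fibre_eq_coset[OF that])
  have sub: "subgroup (h ` N) H"
    using N.subgroup_axioms by (rule subgroup_img_is_subgroup)
  have "group (H\<lparr>carrier := h ` N\<rparr>)"
    by (rule subgroup.subgroup_is_group[OF sub H.group_axioms])
  moreover have "\<iota> \<in> hom (H\<lparr>carrier := h ` N\<rparr>) (G Mod ?K)"
  proof (rule homI)
    fix y z assume "y \<in> carrier (H\<lparr>carrier := h ` N\<rparr>)" "z \<in> carrier (H\<lparr>carrier := h ` N\<rparr>)"
    then obtain u v where "u \<in> N" "v \<in> N" and yz: "y = h u" "z = h v"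
      by auto
    then have u: "u \<in> carrier G" and v: "v \<in> carrier G"
      using N.subset by auto
    then have "\<iota> (h u \<otimes>\<^bsub>H\<^esub> h v) = (?K #> u) <#> (?K #> v)"
      using \<iota>[of "u \<otimes> v"] by (simp add: K.rcos_sum)
    then show "\<iota> (y \<otimes>\<^bsub>H\<lparr>carrier := h ` N\<rparr>\<^esub> z) = \<iota> y \<otimes>\<^bsub>G Mod ?K\<^esub> \<iota> z"
      using u v by (simp add: yz \<iota>)
  next
    fix y assume "y \<in> carrier (H\<lparr>carrier := h ` N\<rparr>)"
    then show "\<iota> y \<in> carrier (G Mod ?K)"
      using N.subset \<iota> by (auto simp: carrier_FactGroup)
  qed
  moreover have "inj_on \<iota> (h ` N)"
  proof (rule inj_onI)
    fix y z assume "y \<in> h ` N" "z \<in> h ` N" and eq: "\<iota> y = \<iota> z"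
    then obtain u where "u \<in> N" "y = h u" by auto
    then have "u \<in> \<iota> y" using N.subset by (auto simp: \<iota>_def)
    with eq show "y = z" by (auto simp: \<iota>_def)
  qed
  moreover have "\<iota> ` h ` N = kernel (G Mod ?K) (G Mod N) \<pi>"
  proof -
    have "kernel (G Mod ?K) (G Mod N) \<pi> = {?K #> x | x. x \<in> carrier G \<and> N #> x = N}"
      unfolding kernel_def[of "G Mod ?K"] carrier_FactGroup one_FactGroup using \<pi> by auto
    also have "\<dots> = {?K #> x | x. x \<in> N}"
      using coset_N N.subset by blast
    also have "\<dots> = (\<lambda>x. \<iota> (h x)) ` N"
      using \<iota> N.subset by (auto simp: image_def)
    finally show ?thesis by (simp add: image_image)
  qed
  moreover have "\<pi> ` carrier (G Mod ?K) = carrier (G Mod N)"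
    using \<pi> by (simp add: carrier_FactGroup image_image)
  ultimately have "short_exact_seq (H\<lparr>carrier := h ` N\<rparr>) \<iota> (G Mod ?K) \<pi> (G Mod N)"
    using \<pi>_hom QK.group_axioms QN.group_axioms
    by (simp add: short_exact_seq_def group_hom_def group_hom_axioms_def)
  then show ?thesis by blast
qed

section \<open>Complex matrix groups\<close>

lemma one_GL [simp]: "\<one>\<^bsub>GL n\<^esub> = 1\<^sub>m n"
  by (simp add: GL_def units_of_def ring_mat_def)

lemma mult_GL [simp]: "A \<otimes>\<^bsub>GL n\<^esub> B = A * B"
  by (simp add: GL_def units_of_def ring_mat_def)

lemma carrier_GL: "carrier (GL n) = {A \<in> carrier_mat n n. det A \<noteq> 0}"
proof -
  have "Units (ring_mat TYPE(complex) n ()) \<subseteq> carrier_mat n n"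
    by (auto simp: Units_def ring_mat_def)
  then show ?thesis
    unfolding GL_def units_of_def
    using unit_imp_det_non_zero[where 'a = complex, of _ n "()"]
      det_non_zero_imp_unit[where 'a = complex, of _ n "()"]
    by auto
qed

lemma GL_mat: "A \<in> carrier (GL n) \<Longrightarrow> A \<in> carrier_mat n n"
  by (simp add: carrier_GL)

lemma group_GL: "group (GL n)"
proof -
  interpret ring "ring_mat TYPE(complex) n ()" by (rule ring_mat)
  show ?thesis unfolding GL_def by (rule units_group)
qed

lemma GL_inverse:
  assumes "M \<in> carrier (GL n)"
  shows "inv\<^bsub>GL n\<^esub> M \<in> carrier_mat n n" "M * inv\<^bsub>GL n\<^esub> M = 1\<^sub>m n" "inv\<^bsub>GL n\<^esub> M * M = 1\<^sub>m n"
proof -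
  interpret group "GL n" by (rule group_GL)
  show "inv\<^bsub>GL n\<^esub> M \<in> carrier_mat n n" "M * inv\<^bsub>GL n\<^esub> M = 1\<^sub>m n" "inv\<^bsub>GL n\<^esub> M * M = 1\<^sub>m n"
    using assms GL_mat r_inv[of M] l_inv[of M] by (auto simp del: r_inv l_inv)
qed

text \<open>The conjugation identities that define \<open>Delta_plus\<close> and \<open>Delta_minus\<close> become
  intertwining equations, which split into blocks without inverting \<open>M\<close>.\<close>

lemma GL_conj_eq_iff:
  assumes M: "M \<in> carrier (GL n)" and A: "A \<in> carrier_mat n n" and B: "B \<in> carrier_mat n n"
  shows "M * A * inv\<^bsub>GL n\<^esub> M = B \<longleftrightarrow> M * A = B * M"
proof -
  note c = GL_mat[OF M] GL_inverse(1)[OF M] A B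
  have "M * A * inv\<^bsub>GL n\<^esub> M * M = M * A" "B * M * inv\<^bsub>GL n\<^esub> M = B"
    using c GL_inverse(2,3)[OF M]
    by (simp_all add: assoc_mult_mat[of _ n n _ n _ n])
  then show ?thesis by metis
qed

section \<open>Translation parts of affine lifts\<close>

lemma carrier_F2 [simp]: "carrier F2 = UNIV"
  by (simp add: F2_def)

lemma auto_F2_inverse:
  assumes "\<psi> \<in> auto F2"
  shows "inv_into UNIV \<psi> (g \<otimes>\<^bsub>F2\<^esub> h) = inv_into UNIV \<psi> g \<otimes>\<^bsub>F2\<^esub> inv_into UNIV \<psi> h"
    and "surj (inv_into UNIV \<psi>)"
proof -
  have bij: "bij \<psi>" and hom: "\<And>g h. \<psi> (g \<otimes>\<^bsub>F2\<^esub> h) = \<psi> g \<otimes>\<^bsub>F2\<^esub> \<psi> h"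
    using assms by (auto simp: auto_def Bij_def hom_def)
  show "surj (inv_into UNIV \<psi>)"
    using bij by (simp add: bij_is_surj bij_imp_bij_inv)
  show "inv_into UNIV \<psi> (g \<otimes>\<^bsub>F2\<^esub> h) = inv_into UNIV \<psi> g \<otimes>\<^bsub>F2\<^esub> inv_into UNIV \<psi> h"
    using bij hom by (metis bij_inv_eq_iff)
qed

lemma Aff_simps [simp]:
  "carrier (Aff n) = carrier_vec n \<times> carrier (GL n)"
  "(v, M) \<otimes>\<^bsub>Aff n\<^esub> (w, N) = (v + M *\<^sub>v w, M * N)"
  "\<one>\<^bsub>Aff n\<^esub> = (0\<^sub>v n, 1\<^sub>m n)"
  by (simp_all add: Aff_def)

text \<open>A lift of \<open>\<rho>\<close> is determined by its translation part, and the translation parts are exactly the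
  crossed homomorphisms, that is, the 1-cocycles with values in the \<open>F2\<close>-module given by \<open>\<rho>\<close>.\<close>

definition crossed_hom :: "nat \<Rightarrow> (f2 \<Rightarrow> complex mat) \<Rightarrow> (f2 \<Rightarrow> complex vec) \<Rightarrow> bool" where
  "crossed_hom n \<rho> u \<longleftrightarrow> (\<forall>g. u g \<in> carrier_vec n) \<and> (\<forall>g h. u (g \<otimes>\<^bsub>F2\<^esub> h) = u g + \<rho> g *\<^sub>v u h)"

locale f2_rep =
  fixes n :: nat and \<rho> :: "f2 \<Rightarrow> complex mat"
  assumes hom: "\<rho> \<in> hom F2 (GL n)"
begin

lemma rep_GL: "\<rho> g \<in> carrier (GL n)"
  using hom by (auto simp: hom_def)

lemma rep_mat [simp]: "\<rho> g \<in> carrier_mat n n"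
  using rep_GL by (rule GL_mat)

lemma rep_dims [simp]: "dim_row (\<rho> g) = n" "dim_col (\<rho> g) = n"
  using rep_mat[of g] by (simp_all del: rep_mat)

lemma rep_mult: "\<rho> (g \<otimes>\<^bsub>F2\<^esub> h) = \<rho> g * \<rho> h"
  using hom by (simp add: hom_def)

lemma lifts_iff: "\<sigma> \<in> lifts n \<rho> \<longleftrightarrow> crossed_hom n \<rho> (\<lambda>g. fst (\<sigma> g)) \<and> (\<forall>g. snd (\<sigma> g) = \<rho> g)"
proof (cases "\<forall>g. snd (\<sigma> g) = \<rho> g")
  case True
  define u where "u g = fst (\<sigma> g)" for g
  have \<sigma>: "\<sigma> = (\<lambda>g. (u g, \<rho> g))"
    using True by (auto simp: u_def fun_eq_iff prod_eq_iff)
  have "\<sigma> \<in> hom F2 (Aff n) \<longleftrightarrow> crossed_hom n \<rho> (\<lambda>g. fst (\<sigma> g))"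
    using rep_GL rep_mult by (simp add: \<sigma> hom_def crossed_hom_def Pi_iff)
  then show ?thesis
    using True by (simp add: lifts_def)
qed (auto simp: lifts_def)

lemma lift_snd: "\<sigma> \<in> lifts n \<rho> \<Longrightarrow> snd (\<sigma> g) = \<rho> g"
  by (simp add: lifts_iff)

lemma lift_pair: "\<sigma> \<in> lifts n \<rho> \<Longrightarrow> \<sigma> g = (fst (\<sigma> g), \<rho> g)"
  by (metis lift_snd prod.collapse)

lemma lift_fst [simp]: "\<sigma> \<in> lifts n \<rho> \<Longrightarrow> fst (\<sigma> g) \<in> carrier_vec n"
  by (simp add: lifts_iff crossed_hom_def)

lemma lift_dim [simp]: "\<sigma> \<in> lifts n \<rho> \<Longrightarrow> dim_vec (fst (\<sigma> g)) = n"
  using lift_fst[of \<sigma> g] by (simp del: lift_fst)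

lemma lift_fst_mult: "\<sigma> \<in> lifts n \<rho> \<Longrightarrow> fst (\<sigma> (g \<otimes>\<^bsub>F2\<^esub> h)) = fst (\<sigma> g) + \<rho> g *\<^sub>v fst (\<sigma> h)"
  by (simp add: lifts_iff crossed_hom_def)

text \<open>Conjugation by a translation changes the translation part by a coboundary, so the classes of
  lifts are the classes of the first cohomology group.\<close>

lemma lift_rel_iff:
  "(\<sigma>, \<tau>) \<in> lift_rel n \<rho> \<longleftrightarrow> \<sigma> \<in> lifts n \<rho> \<and> \<tau> \<in> lifts n \<rho> \<and>
     (\<exists>v \<in> carrier_vec n. \<forall>g. fst (\<tau> g) = fst (\<sigma> g) + (v - \<rho> g *\<^sub>v v))"
proof -
  have "(\<tau> g = (v, 1\<^sub>m n) \<otimes>\<^bsub>Aff n\<^esub> \<sigma> g \<otimes>\<^bsub>Aff n\<^esub> (- v, 1\<^sub>m n)) \<longleftrightarrow>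
        fst (\<tau> g) = fst (\<sigma> g) + (v - \<rho> g *\<^sub>v v)"
    if \<sigma>: "\<sigma> \<in> lifts n \<rho>" and \<tau>: "\<tau> \<in> lifts n \<rho>" and v: "v \<in> carrier_vec n" for g v
  proof -
    have dims: "dim_vec v = n" "dim_vec (fst (\<sigma> g)) = n" "dim_row (\<rho> g) = n" "dim_col (\<rho> g) = n"
      using v \<sigma> by auto
    have "(v, 1\<^sub>m n) \<otimes>\<^bsub>Aff n\<^esub> \<sigma> g \<otimes>\<^bsub>Aff n\<^esub> (- v, 1\<^sub>m n) =
          (v + fst (\<sigma> g) + \<rho> g *\<^sub>v (- v), \<rho> g)"
      using v lift_fst[OF \<sigma>, of g] rep_mat[of g]
      by (subst lift_pair[OF \<sigma>]) simp
    also have "v + fst (\<sigma> g) + \<rho> g *\<^sub>v (- v) = fst (\<sigma> g) + (v - \<rho> g *\<^sub>v v)"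
      by (rule eq_vecI) (simp_all add: dims)
    finally show ?thesis
      by (subst lift_pair[OF \<tau>]) simp
  qed
  then show ?thesis
    by (auto simp: lift_rel_def)
qed

lemma equiv_lift_rel: "equiv (lifts n \<rho>) (lift_rel n \<rho>)"
proof (rule equivI)
  show "lift_rel n \<rho> \<subseteq> lifts n \<rho> \<times> lifts n \<rho>"
    by (auto simp: lift_rel_def)
  show "refl_on (lifts n \<rho>) (lift_rel n \<rho>)"
  proof (rule refl_onI)
    fix \<sigma> assume \<sigma>: "\<sigma> \<in> lifts n \<rho>"
    have "fst (\<sigma> g) = fst (\<sigma> g) + (0\<^sub>v n - \<rho> g *\<^sub>v 0\<^sub>v n)" for g
    proof -
      have "\<rho> g *\<^sub>v 0\<^sub>v n = 0\<^sub>v n"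
        by (intro eq_vecI) (auto simp: scalar_prod_def)
      then show ?thesis using lift_fst[OF \<sigma>, of g] by simp
    qed
    then show "(\<sigma>, \<sigma>) \<in> lift_rel n \<rho>"
      using \<sigma> unfolding lift_rel_iff by (meson zero_carrier_vec)
  qed
  show "sym (lift_rel n \<rho>)"
  proof (rule symI)
    fix \<sigma> \<tau> assume "(\<sigma>, \<tau>) \<in> lift_rel n \<rho>"
    then obtain v where \<sigma>: "\<sigma> \<in> lifts n \<rho>" and \<tau>: "\<tau> \<in> lifts n \<rho>" and v: "v \<in> carrier_vec n"
      and eq: "\<And>g. fst (\<tau> g) = fst (\<sigma> g) + (v - \<rho> g *\<^sub>v v)"
      by (auto simp: lift_rel_iff)
    have "fst (\<sigma> g) = fst (\<tau> g) + (- v - \<rho> g *\<^sub>v (- v))" for g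
      using v \<sigma> by (intro eq_vecI) (auto simp: eq)
    then show "(\<tau>, \<sigma>) \<in> lift_rel n \<rho>"
      using \<sigma> \<tau> v unfolding lift_rel_iff by (meson uminus_carrier_vec)
  qed
  show "trans (lift_rel n \<rho>)"
  proof (rule transI)
    fix \<sigma> \<tau> \<nu> assume "(\<sigma>, \<tau>) \<in> lift_rel n \<rho>" "(\<tau>, \<nu>) \<in> lift_rel n \<rho>"
    then obtain v w where \<sigma>: "\<sigma> \<in> lifts n \<rho>" and \<nu>: "\<nu> \<in> lifts n \<rho>"
      and v: "v \<in> carrier_vec n" and w: "w \<in> carrier_vec n"
      and eq: "\<And>g. fst (\<tau> g) = fst (\<sigma> g) + (v - \<rho> g *\<^sub>v v)"
        "\<And>g. fst (\<nu> g) = fst (\<tau> g) + (w - \<rho> g *\<^sub>v w)"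
      by (auto simp: lift_rel_iff)
    have "fst (\<nu> g) = fst (\<sigma> g) + ((v + w) - \<rho> g *\<^sub>v (v + w))" for g
      using v w \<sigma> by (intro eq_vecI) (auto simp: eq mult_add_distrib_mat_vec[OF rep_mat v w])
    then show "(\<sigma>, \<nu>) \<in> lift_rel n \<rho>"
      using \<sigma> \<nu> v w unfolding lift_rel_iff by (meson add_carrier_vec)
  qed
qed

lemma lift_class_self: "\<sigma> \<in> lifts n \<rho> \<Longrightarrow> \<sigma> \<in> lift_class n \<rho> \<sigma>"
  unfolding lift_class_def by (rule equiv_class_self[OF equiv_lift_rel])

lemma lift_class_eq_iff:
  assumes "\<sigma> \<in> lifts n \<rho>" "\<tau> \<in> lifts n \<rho>"
  shows "lift_class n \<rho> \<sigma> = lift_class n \<rho> \<tau> \<longleftrightarrow>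
    (\<exists>v \<in> carrier_vec n. \<forall>g. fst (\<tau> g) = fst (\<sigma> g) + (v - \<rho> g *\<^sub>v v))"
  using assms eq_equiv_class_iff[OF equiv_lift_rel assms]
  by (simp add: lift_class_def lift_rel_iff)

lemma mem_lift_class_iff:
  assumes "\<sigma> \<in> lifts n \<rho>"
  shows "\<tau> \<in> lift_class n \<rho> \<sigma> \<longleftrightarrow> \<tau> \<in> lifts n \<rho> \<and> lift_class n \<rho> \<tau> = lift_class n \<rho> \<sigma>"
  using eq_equiv_class_iff[OF equiv_lift_rel assms, of \<tau>] assms
  by (auto simp: lift_class_def lift_rel_iff)

lemma lift_addI:
  assumes "\<sigma> \<in> lifts n \<rho>" "\<tau> \<in> lifts n \<rho>"
  shows "(\<lambda>g. (fst (\<sigma> g) + fst (\<tau> g), \<rho> g)) \<in> lifts n \<rho>"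
  using assms
  by (auto simp: lifts_iff crossed_hom_def mult_add_distrib_mat_vec[OF rep_mat]
      intro!: eq_vecI)

lemma lift_smultI:
  assumes "\<sigma> \<in> lifts n \<rho>"
  shows "(\<lambda>g. (c \<cdot>\<^sub>v fst (\<sigma> g), \<rho> g)) \<in> lifts n \<rho>"
  using assms
  by (auto simp: lifts_iff crossed_hom_def mult_mat_vec[OF rep_mat] algebra_simps intro!: eq_vecI)

lemma lift_class_add:
  assumes \<sigma>: "\<sigma> \<in> lifts n \<rho>" and \<tau>: "\<tau> \<in> lifts n \<rho>"
  shows "lift_class n \<rho> \<sigma> \<oplus>\<^bsub>lift_quotient n \<rho>\<^esub> lift_class n \<rho> \<tau> =
    lift_class n \<rho> (\<lambda>g. (fst (\<sigma> g) + fst (\<tau> g), \<rho> g))"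
proof -
  have "lift_class n \<rho> (\<lambda>g. (fst (\<sigma>' g) + fst (\<tau>' g), \<rho> g)) =
        lift_class n \<rho> (\<lambda>g. (fst (\<sigma> g) + fst (\<tau> g), \<rho> g))"
    if "\<sigma>' \<in> lift_class n \<rho> \<sigma>" "\<tau>' \<in> lift_class n \<rho> \<tau>" for \<sigma>' \<tau>'
  proof -
    from that have \<sigma>': "\<sigma>' \<in> lifts n \<rho>" and \<tau>': "\<tau>' \<in> lifts n \<rho>"
      and "lift_class n \<rho> \<sigma>' = lift_class n \<rho> \<sigma>" "lift_class n \<rho> \<tau>' = lift_class n \<rho> \<tau>"
      using \<sigma> \<tau> by (auto simp: mem_lift_class_iff)
    then obtain v w where v: "v \<in> carrier_vec n" and w: "w \<in> carrier_vec n"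
      and eq: "\<And>g. fst (\<sigma> g) = fst (\<sigma>' g) + (v - \<rho> g *\<^sub>v v)"
        "\<And>g. fst (\<tau> g) = fst (\<tau>' g) + (w - \<rho> g *\<^sub>v w)"
      using \<sigma> \<tau> by (auto simp: lift_class_eq_iff)
    have "fst (\<sigma> g) + fst (\<tau> g) = fst (\<sigma>' g) + fst (\<tau>' g) + ((v + w) - \<rho> g *\<^sub>v (v + w))" for g
      using v w \<sigma>' \<tau>' by (intro eq_vecI) (auto simp: eq mult_add_distrib_mat_vec[OF rep_mat v w])
    then show ?thesis
      unfolding lift_class_eq_iff[OF lift_addI[OF \<sigma>' \<tau>'] lift_addI[OF \<sigma> \<tau>]]
      using v w by (intro bexI[of _ "v + w"]) simp_all
  qed
  then have "(\<Union>\<tau>'\<in>lift_class n \<rho> \<tau>. lift_class n \<rho> (\<lambda>g. (fst (\<sigma>' g) + fst (\<tau>' g), \<rho> g))) =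
      lift_class n \<rho> (\<lambda>g. (fst (\<sigma> g) + fst (\<tau> g), \<rho> g))" if "\<sigma>' \<in> lift_class n \<rho> \<sigma>" for \<sigma>'
    using that by (intro UN_constant_eq[OF lift_class_self[OF \<tau>]] ballI)
  then have "(\<Union>\<sigma>'\<in>lift_class n \<rho> \<sigma>. \<Union>\<tau>'\<in>lift_class n \<rho> \<tau>.
        lift_class n \<rho> (\<lambda>g. (fst (\<sigma>' g) + fst (\<tau>' g), \<rho> g))) =
      lift_class n \<rho> (\<lambda>g. (fst (\<sigma> g) + fst (\<tau> g), \<rho> g))"
    by (intro UN_constant_eq[OF lift_class_self[OF \<sigma>]] ballI)
  then show ?thesis
    unfolding lift_quotient_def lift_space_def ring.simps .
qed

lemma lift_class_smult:
  assumes \<sigma>: "\<sigma> \<in> lifts n \<rho>"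
  shows "c \<odot>\<^bsub>lift_quotient n \<rho>\<^esub> lift_class n \<rho> \<sigma> = lift_class n \<rho> (\<lambda>g. (c \<cdot>\<^sub>v fst (\<sigma> g), \<rho> g))"
proof -
  have "lift_class n \<rho> (\<lambda>g. (c \<cdot>\<^sub>v fst (\<sigma>' g), \<rho> g)) = lift_class n \<rho> (\<lambda>g. (c \<cdot>\<^sub>v fst (\<sigma> g), \<rho> g))"
    if "\<sigma>' \<in> lift_class n \<rho> \<sigma>" for \<sigma>'
  proof -
    from that have \<sigma>': "\<sigma>' \<in> lifts n \<rho>" and "lift_class n \<rho> \<sigma>' = lift_class n \<rho> \<sigma>"
      using \<sigma> by (auto simp: mem_lift_class_iff)
    then obtain v where v: "v \<in> carrier_vec n"
      and eq: "\<And>g. fst (\<sigma> g) = fst (\<sigma>' g) + (v - \<rho> g *\<^sub>v v)"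
      using \<sigma> by (auto simp: lift_class_eq_iff)
    have "c \<cdot>\<^sub>v fst (\<sigma> g) = c \<cdot>\<^sub>v fst (\<sigma>' g) + (c \<cdot>\<^sub>v v - \<rho> g *\<^sub>v (c \<cdot>\<^sub>v v))" for g
      using v \<sigma>' by (intro eq_vecI) (auto simp: eq mult_mat_vec[OF rep_mat v] algebra_simps)
    then show ?thesis
      unfolding lift_class_eq_iff[OF lift_smultI[OF \<sigma>'] lift_smultI[OF \<sigma>]]
      using v by (intro bexI[of _ "c \<cdot>\<^sub>v v"]) simp_all
  qed
  then have "(\<Union>\<sigma>'\<in>lift_class n \<rho> \<sigma>. lift_class n \<rho> (\<lambda>g. (c \<cdot>\<^sub>v fst (\<sigma>' g), \<rho> g))) =
      lift_class n \<rho> (\<lambda>g. (c \<cdot>\<^sub>v fst (\<sigma> g), \<rho> g))"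
    by (intro UN_constant_eq[OF lift_class_self[OF \<sigma>]] ballI)
  then show ?thesis
    unfolding lift_quotient_def lift_space_def module.simps .
qed

lemma lift_class_zero: "\<zero>\<^bsub>lift_quotient n \<rho>\<^esub> = lift_class n \<rho> (\<lambda>g. (0\<^sub>v n, \<rho> g))"
  by (simp add: lift_quotient_def lift_space_def)

end

section \<open>Families of lifts\<close>

definition translation_mat :: "nat \<Rightarrow> nat \<Rightarrow> (nat \<Rightarrow> f2 \<Rightarrow> aff) \<Rightarrow> f2 \<Rightarrow> complex mat" where
  "translation_mat n m \<sigma> g = mat_of_cols n (map (\<lambda>i. fst (\<sigma> i g)) [0..<m])"

lemma translation_mat_carrier [simp]: "translation_mat n m \<sigma> g \<in> carrier_mat n m"
  unfolding translation_mat_def by (metis length_map length_upt minus_nat.diff_0 mat_of_cols_carrier(1))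

lemma translation_mat_dims [simp]:
  "dim_row (translation_mat n m \<sigma> g) = n" "dim_col (translation_mat n m \<sigma> g) = m"
  by (simp_all add: translation_mat_def)

lemma translation_mat_index [simp]:
  "i < n \<Longrightarrow> j < m \<Longrightarrow> translation_mat n m \<sigma> g $$ (i, j) = fst (\<sigma> j g) $ i"
  by (simp add: translation_mat_def mat_of_cols_index)

definition lift_comb ::
    "nat \<Rightarrow> (f2 \<Rightarrow> complex mat) \<Rightarrow> nat \<Rightarrow> (nat \<Rightarrow> f2 \<Rightarrow> aff) \<Rightarrow> complex vec \<Rightarrow> f2 \<Rightarrow> aff" where
  "lift_comb n \<rho> m \<sigma> c g = (translation_mat n m \<sigma> g *\<^sub>v c, \<rho> g)"

locale lift_family = f2_rep +
  fixes m :: nat and \<sigma> :: "nat \<Rightarrow> f2 \<Rightarrow> aff"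
  assumes lift: "\<And>i. i < m \<Longrightarrow> \<sigma> i \<in> lifts n \<rho>"
begin

abbreviation "Q \<equiv> translation_mat n m \<sigma>"

lemma col_Q: "i < m \<Longrightarrow> col (Q g) i = fst (\<sigma> i g)"
  using lift by (intro eq_vecI) auto

lemma Q_mult: "Q (g \<otimes>\<^bsub>F2\<^esub> h) = Q g + \<rho> g * Q h"
  by (rule eq_matI) (simp_all add: lift_fst_mult[OF lift] lift_dim[OF lift] col_Q)

lemma lift_comb_lift:
  assumes c: "c \<in> carrier_vec m"
  shows "lift_comb n \<rho> m \<sigma> c \<in> lifts n \<rho>"
proof -
  have "Q (g \<otimes>\<^bsub>F2\<^esub> h) *\<^sub>v c = Q g *\<^sub>v c + \<rho> g *\<^sub>v (Q h *\<^sub>v c)" for g h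
  proof -
    have "Q (g \<otimes>\<^bsub>F2\<^esub> h) *\<^sub>v c = Q g *\<^sub>v c + (\<rho> g * Q h) *\<^sub>v c"
      unfolding Q_mult
      by (rule add_mult_distrib_mat_vec[OF translation_mat_carrier _ c])
        (rule mult_carrier_mat[OF rep_mat translation_mat_carrier])
    then show ?thesis
      using assoc_mult_mat_vec[OF rep_mat translation_mat_carrier c] by simp
  qed
  then show ?thesis
    using c mult_mat_vec_carrier[OF translation_mat_carrier c]
    by (simp add: lifts_iff crossed_hom_def lift_comb_def)
qed

lemma translation_mat_Suc_mult:
  assumes "p < m"
  shows "translation_mat n (Suc p) \<sigma> g *\<^sub>v vec (Suc p) a =
    translation_mat n p \<sigma> g *\<^sub>v vec p a + a p \<cdot>\<^sub>v fst (\<sigma> p g)"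
  using assms lift[of p]
  by (intro eq_vecI) (auto simp: scalar_prod_def mult.commute)

text \<open>Linear combinations of classes are computed on representatives. The induction adds one lift at
  a time, which is why \<open>lift_comb\<close> carries the number of lifts as a parameter.\<close>

lemma lincomb_lift_classes:
  fixes k :: nat and W :: "(f2 \<Rightarrow> aff) set set"
  defines "V \<equiv> (lift_quotient_k k n \<rho>)\<lparr>carrier := W\<rparr>"
  assumes vs: "vectorspace class_ring V"
    and mem: "\<And>i. i < m \<Longrightarrow> lift_class n \<rho> (\<sigma> i) \<in> W"
    and inj: "inj_on (\<lambda>i. lift_class n \<rho> (\<sigma> i)) {..<m}"
  shows "LinearCombinations.module.lincomb V a ((\<lambda>i. lift_class n \<rho> (\<sigma> i)) ` {..<m}) =
    lift_class n \<rho> (lift_comb n \<rho> m \<sigma> (vec m (\<lambda>i. a (lift_class n \<rho> (\<sigma> i)))))"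
proof -
  interpret V: vectorspace class_ring V by (rule vs)
  let ?b = "\<lambda>i. lift_class n \<rho> (\<sigma> i)" and ?c = "\<lambda>i. a (lift_class n \<rho> (\<sigma> i))"
  have car: "carrier V = W" and V_add: "X \<oplus>\<^bsub>V\<^esub> Y = X \<oplus>\<^bsub>lift_quotient n \<rho>\<^esub> Y"
    and V_smult: "z \<odot>\<^bsub>V\<^esub> X = z \<odot>\<^bsub>lift_quotient n \<rho>\<^esub> X" and V_zero: "\<zero>\<^bsub>V\<^esub> = \<zero>\<^bsub>lift_quotient n \<rho>\<^esub>"
    for X Y z
    by (simp_all add: V_def lift_quotient_k_def)
  have summand: "?c i \<odot>\<^bsub>V\<^esub> ?b i \<in> carrier V" if "i < m" for i
    using mem[OF that] car by (intro V.smult_closed) auto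
  have "(\<Oplus>\<^bsub>V\<^esub>i\<in>{..<p}. ?c i \<odot>\<^bsub>V\<^esub> ?b i) = lift_class n \<rho> (lift_comb n \<rho> p \<sigma> (vec p ?c))"
    if "p \<le> m" for p
    using that
  proof (induction p)
    case 0
    have "lift_comb n \<rho> 0 \<sigma> (vec 0 ?c) = (\<lambda>g. (0\<^sub>v n, \<rho> g))"
      by (auto simp: lift_comb_def scalar_prod_def fun_eq_iff intro!: eq_vecI)
    then show ?case
      by (simp add: V_zero lift_class_zero)
  next
    case (Suc p)
    then have p: "p < m" by simp
    interpret P: lift_family n \<rho> p \<sigma>
      using lift Suc.prems by unfold_locales auto
    have "(\<Oplus>\<^bsub>V\<^esub>i\<in>{..<Suc p}. ?c i \<odot>\<^bsub>V\<^esub> ?b i) =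
          ?c p \<odot>\<^bsub>V\<^esub> ?b p \<oplus>\<^bsub>V\<^esub> (\<Oplus>\<^bsub>V\<^esub>i\<in>{..<p}. ?c i \<odot>\<^bsub>V\<^esub> ?b i)"
      unfolding lessThan_Suc using summand Suc.prems by (intro V.M.finsum_insert) auto
    also have "\<dots> = (\<Oplus>\<^bsub>V\<^esub>i\<in>{..<p}. ?c i \<odot>\<^bsub>V\<^esub> ?b i) \<oplus>\<^bsub>V\<^esub> ?c p \<odot>\<^bsub>V\<^esub> ?b p"
      using summand Suc.prems by (intro V.M.a_comm V.M.finsum_closed) auto
    also have "\<dots> = lift_class n \<rho> (lift_comb n \<rho> p \<sigma> (vec p ?c)) \<oplus>\<^bsub>lift_quotient n \<rho>\<^esub>
        lift_class n \<rho> (\<lambda>g. (?c p \<cdot>\<^sub>v fst (\<sigma> p g), \<rho> g))"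
      using Suc lift by (simp add: V_add V_smult lift_class_smult)
    also have "\<dots> = lift_class n \<rho> (lift_comb n \<rho> (Suc p) \<sigma> (vec (Suc p) ?c))"
      using Suc.prems
      unfolding lift_class_add[OF P.lift_comb_lift[OF vec_carrier] lift_smultI[OF lift[OF p]]]
      by (simp add: lift_comb_def[abs_def] translation_mat_Suc_mult)
    finally show ?case .
  qed
  moreover have "V.lincomb a (?b ` {..<m}) = (\<Oplus>\<^bsub>V\<^esub>i\<in>{..<m}. ?c i \<odot>\<^bsub>V\<^esub> ?b i)"
    unfolding V.lincomb_def using summand
    by (intro V.M.finsum_reindex[OF _ inj]) auto
  ultimately show ?thesis
    by simp
qed

end

text \<open>What the choice of the lifts means for matrices. Spanning turns membership in \<open>W\<close> into a
  coefficient vector. Independence says that the only linear combination of the lifts whose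
  translation part is a coboundary is the trivial one, because a coboundary is the translation part
  of a lift in the zero class.\<close>

lemma (in lift_family)
  fixes k :: nat and W :: "(f2 \<Rightarrow> aff) set set"
  defines "V \<equiv> (lift_quotient_k k n \<rho>)\<lparr>carrier := W\<rparr>"
  assumes sub: "subspace class_ring W (lift_quotient_k k n \<rho>)"
    and inj: "inj_on (\<lambda>i. lift_class n \<rho> (\<sigma> i)) {..<m}"
    and basis: "vectorspace.basis class_ring V ((\<lambda>i. lift_class n \<rho> (\<sigma> i)) ` {..<m})"
  shows lift_classes_span: "X \<in> W \<Longrightarrow> \<exists>c \<in> carrier_vec m. X = lift_class n \<rho> (lift_comb n \<rho> m \<sigma> c)"
    and lift_classes_indep: "c \<in> carrier_vec m \<Longrightarrow> w \<in> carrier_vec n \<Longrightarrow>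
      (\<And>g. Q g *\<^sub>v c = w - \<rho> g *\<^sub>v w) \<Longrightarrow> c = 0\<^sub>v m"
    and lift_class_mem: "i < m \<Longrightarrow> lift_class n \<rho> (\<sigma> i) \<in> W"
proof -
  interpret V0: vectorspace class_ring "lift_quotient_k k n \<rho>"
    using sub by (simp add: subspace_def)
  have vs: "vectorspace class_ring V"
    unfolding V_def by (rule V0.subspace_is_vs[OF sub])
  interpret V: vectorspace class_ring V by (rule vs)
  let ?b = "\<lambda>i. lift_class n \<rho> (\<sigma> i)"
  have car: "carrier V = W" by (simp add: V_def)
  have gen: "V.span (?b ` {..<m}) = W" and indep: "\<not> V.lin_dep (?b ` {..<m})"
    and subset: "?b ` {..<m} \<subseteq> W"
    using basis car by (simp_all add: V.basis_def)
  show mem: "?b i \<in> W" if "i < m" for i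
    using that subset by auto
  note lincomb = lincomb_lift_classes[OF vs[unfolded V_def] mem inj, folded V_def]
  show "\<exists>c \<in> carrier_vec m. X = lift_class n \<rho> (lift_comb n \<rho> m \<sigma> c)" if "X \<in> W"
  proof -
    have "X \<in> V.span (?b ` {..<m})"
      using that gen by simp
    then obtain a where "V.lincomb a (?b ` {..<m}) = X"
      using V.finite_in_span[OF _ subset[folded car]] by blast
    then show ?thesis
      using lincomb[of a] by (intro bexI[OF _ vec_carrier]) auto
  qed
  show "c = 0\<^sub>v m" if c: "c \<in> carrier_vec m" and w: "w \<in> carrier_vec n"
    and cob: "\<And>g. Q g *\<^sub>v c = w - \<rho> g *\<^sub>v w"
  proof (rule ccontr)
    assume "c \<noteq> 0\<^sub>v m"
    then obtain i where i: "i < m" "c $ i \<noteq> 0"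
      using c by (metis carrier_vecD eq_vecI index_zero_vec)
    \<comment> \<open>The coefficients indexed by classes instead of by positions.\<close>
    define a where "a X = c $ (inv_into {..<m} ?b X)" for X
    have a: "a (?b j) = c $ j" if "j < m" for j
      using that inv_into_f_f[OF inj] by (simp add: a_def)
    have "vec m (\<lambda>i. a (?b i)) = c"
      using c a by (intro eq_vecI) auto
    then have "V.lincomb a (?b ` {..<m}) = lift_class n \<rho> (lift_comb n \<rho> m \<sigma> c)"
      using lincomb[of a] by simp
    also have "\<dots> = lift_class n \<rho> (\<lambda>g. (0\<^sub>v n, \<rho> g))"
    proof -
      have zero: "(\<lambda>g. (0\<^sub>v n, \<rho> g)) \<in> lifts n \<rho>"
        by (auto simp: lifts_iff crossed_hom_def scalar_prod_def intro!: eq_vecI)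
      have "fst (lift_comb n \<rho> m \<sigma> c g) = fst (0\<^sub>v n, \<rho> g) + (w - \<rho> g *\<^sub>v w)" for g
        using w cob by (simp add: lift_comb_def) (intro eq_vecI, auto)
      then show ?thesis
        using lift_class_eq_iff[OF zero lift_comb_lift[OF c]] w by blast
    qed
    also have "\<dots> = \<zero>\<^bsub>V\<^esub>"
      by (simp add: V_def lift_quotient_k_def lift_class_zero)
    finally have "V.lincomb a (?b ` {..<m}) = \<zero>\<^bsub>V\<^esub>" .
    then have "V.lin_dep (?b ` {..<m})"
      unfolding V.lin_dep_def using i a
      by (intro exI[of _ "?b ` {..<m}"] exI[of _ a] exI[of _ "?b i"]) auto
    with indep show False by simp
  qed
qed

section \<open>The extended representation\<close>

lemma four_block_mat_inject:
  assumes "four_block_mat A B C D = four_block_mat A' B' C' D'"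
    and "A \<in> carrier_mat p q" "B \<in> carrier_mat p s" "D \<in> carrier_mat r s"
    and "A' \<in> carrier_mat p q" "B' \<in> carrier_mat p s" "D' \<in> carrier_mat r s"
  shows "A = A'" "B = B'"
proof -
  have eq: "four_block_mat A B C D $$ (i, j) = four_block_mat A' B' C' D' $$ (i, j)" for i j
    using assms(1) by simp
  show "A = A'"
  proof (rule eq_matI)
    fix i j assume "i < dim_row A'" "j < dim_col A'"
    then show "A $$ (i, j) = A' $$ (i, j)"
      using eq[of i j] assms(2-) by auto
  qed (use assms(2-) in auto)
  show "B = B'"
  proof (rule eq_matI)
    fix i j assume "i < dim_row B'" "j < dim_col B'"
    then show "B $$ (i, j) = B' $$ (i, j)"
      using eq[of i "q + j"] assms(2-) by auto
  qed (use assms(2-) in auto)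
qed

lemma unipotent_block_mult:
  fixes B C :: "'a :: semiring_1 mat"
  assumes "B \<in> carrier_mat n m" "C \<in> carrier_mat n m"
  shows "four_block_mat (1\<^sub>m n) B (0\<^sub>m m n) (1\<^sub>m m) * four_block_mat (1\<^sub>m n) C (0\<^sub>m m n) (1\<^sub>m m) =
    four_block_mat (1\<^sub>m n) (B + C) (0\<^sub>m m n) (1\<^sub>m m)"
  using assms left_mult_one_mat[OF one_carrier_mat[of n], where 'a = 'a]
    left_mult_one_mat[OF one_carrier_mat[of m], where 'a = 'a]
  by (subst mult_four_block_mat[of _ n n _ m _ m _ _ n _ m])
    (auto simp: comm_add_mat[of C n m B] left_mult_one_mat[of C n m] right_mult_one_mat[of B n m])

context lift_family
begin

abbreviation "ext \<equiv> extended_rep n m \<rho> \<sigma>"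

lemma ext_block: "ext g = four_block_mat (\<rho> g) (Q g) (0\<^sub>m m n) (1\<^sub>m m)"
  by (simp add: extended_rep_def translation_mat_def)

lemma ext_mat [simp]: "ext g \<in> carrier_mat (n + m) (n + m)"
  unfolding ext_block by (rule four_block_carrier_mat) auto

lemma ext_hom: "ext \<in> hom F2 (GL (n + m))"
proof (rule homI)
  fix g
  have "det (ext g) = det (\<rho> g) * det (1\<^sub>m m)"
    unfolding ext_block
    by (rule det_four_block_mat_lower_left_zero[OF rep_mat translation_mat_carrier HOL.refl one_carrier_mat])
  then show "ext g \<in> carrier (GL (n + m))"
    using rep_GL[of g] ext_mat[of g] by (simp add: carrier_GL)
next
  fix g h
  have "ext g * ext h = four_block_mat (\<rho> g * \<rho> h + Q g * 0\<^sub>m m n) (\<rho> g * Q h + Q g * 1\<^sub>m m)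
      (0\<^sub>m m n * \<rho> h + 1\<^sub>m m * 0\<^sub>m m n) (0\<^sub>m m n * Q h + 1\<^sub>m m * 1\<^sub>m m)"
    unfolding ext_block
    by (rule mult_four_block_mat[of _ n n _ m _ m _ _ n _ m]) auto
  also have "\<dots> = ext (g \<otimes>\<^bsub>F2\<^esub> h)"
    unfolding ext_block
  proof (rule cong_four_block_mat)
    have c: "\<rho> g * \<rho> h \<in> carrier_mat n n" "\<rho> g * Q h \<in> carrier_mat n m"
      by (rule mult_carrier_mat[of _ n n]; simp)+
    show "\<rho> g * \<rho> h + Q g * 0\<^sub>m m n = \<rho> (g \<otimes>\<^bsub>F2\<^esub> h)"
      using c by (simp add: rep_mult right_mult_zero_mat[of _ n m])
    show "\<rho> g * Q h + Q g * 1\<^sub>m m = Q (g \<otimes>\<^bsub>F2\<^esub> h)"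
      using c by (simp add: Q_mult right_mult_one_mat[of _ n m] comm_add_mat[of "Q g" n m])
  qed (simp_all add: left_mult_zero_mat[of _ n n] left_mult_zero_mat[of _ n m])
  finally show "ext (g \<otimes>\<^bsub>F2\<^esub> h) = ext g \<otimes>\<^bsub>GL (n + m)\<^esub> ext h"
    by simp
qed

lemma ext_kernel_iff: "g \<in> kernel F2 (GL (n + m)) ext \<longleftrightarrow> \<rho> g = 1\<^sub>m n \<and> Q g = 0\<^sub>m n m"
proof
  assume "g \<in> kernel F2 (GL (n + m)) ext"
  then have eq: "four_block_mat (\<rho> g) (Q g) (0\<^sub>m m n) (1\<^sub>m m) =
      four_block_mat (1\<^sub>m n) (0\<^sub>m n m) (0\<^sub>m m n) (1\<^sub>m m)"
    by (simp add: kernel_def ext_block)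
  show "\<rho> g = 1\<^sub>m n \<and> Q g = 0\<^sub>m n m"
    using four_block_mat_inject[OF eq, of n n m m] by simp
qed (simp add: kernel_def ext_block)

lemma ext_image_kernel:
  assumes "x \<in> ext ` kernel F2 (GL n) \<rho>"
  obtains B where "B \<in> carrier_mat n m" "x = four_block_mat (1\<^sub>m n) B (0\<^sub>m m n) (1\<^sub>m m)"
proof -
  obtain g where "\<rho> g = 1\<^sub>m n" "x = ext g"
    using assms by (auto simp: kernel_def)
  then show thesis
    using that[of "Q g"] by (simp add: ext_block)
qed

lemma group_ext_image_kernel: "group ((GL (n + m))\<lparr>carrier := ext ` kernel F2 (GL n) \<rho>\<rparr>)"
proof -
  interpret \<rho>: group_hom F2 "GL n" \<rho>
    by (intro group_hom.intro group_hom_axioms.intro group_F2 group_GL hom)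
  interpret E: group_hom F2 "GL (n + m)" ext
    by (intro group_hom.intro group_hom_axioms.intro group_F2 group_GL ext_hom)
  show ?thesis
    by (rule subgroup.subgroup_is_group[OF E.subgroup_img_is_subgroup[OF \<rho>.subgroup_kernel] group_GL])
qed

text \<open>On \<open>ker \<rho>\<close> the diagonal blocks are identities, so \<open>ext ` ker \<rho>\<close> is a subgroup of the matrices
  \<open>(1, B; 0, 1)\<close>. These multiply by adding the blocks \<open>B\<close>, and so inherit commutativity and
  torsion-freeness from the additive group of complex \<open>n \<times> m\<close> matrices.\<close>

lemma comm_group_ext_image_kernel:
  "comm_group ((GL (n + m))\<lparr>carrier := ext ` kernel F2 (GL n) \<rho>\<rparr>)" (is "comm_group ?K")
proof (rule group.group_comm_groupI[OF group_ext_image_kernel])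
  fix x y assume "x \<in> carrier ?K" "y \<in> carrier ?K"
  then have x: "x \<in> ext ` kernel F2 (GL n) \<rho>" and y: "y \<in> ext ` kernel F2 (GL n) \<rho>"
    by simp_all
  obtain B where "B \<in> carrier_mat n m" "x = four_block_mat (1\<^sub>m n) B (0\<^sub>m m n) (1\<^sub>m m)"
    using x by (rule ext_image_kernel)
  moreover obtain C where "C \<in> carrier_mat n m" "y = four_block_mat (1\<^sub>m n) C (0\<^sub>m m n) (1\<^sub>m m)"
    using y by (rule ext_image_kernel)
  ultimately show "x \<otimes>\<^bsub>?K\<^esub> y = y \<otimes>\<^bsub>?K\<^esub> x"
    by (simp add: unipotent_block_mult comm_add_mat[of B n m C])
qed

lemma torsion_free_ext_image_kernel:
  "torsion_free ((GL (n + m))\<lparr>carrier := ext ` kernel F2 (GL n) \<rho>\<rparr>)" (is "torsion_free ?K")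
  unfolding torsion_free_def
proof (intro ballI allI impI)
  interpret K: Group.group ?K by (rule group_ext_image_kernel)
  fix x and j :: nat
  assume x: "x \<in> carrier ?K" and j: "0 < j" and eq: "x [^]\<^bsub>?K\<^esub> j = \<one>\<^bsub>?K\<^esub>"
  let ?U = "\<lambda>B. four_block_mat (1\<^sub>m n) B (0\<^sub>m m n) (1\<^sub>m m)"
  obtain B where B: "B \<in> carrier_mat n m" and xB: "x = ?U B"
    by (rule ext_image_kernel) (use x in auto)
  have "x [^]\<^bsub>?K\<^esub> i = ?U (of_nat i \<cdot>\<^sub>m B)" for i :: nat
  proof (induction i)
    case 0
    have "of_nat 0 \<cdot>\<^sub>m B = 0\<^sub>m n m"
      using B by (intro eq_matI) auto
    then show ?case by simp
  next
    case (Suc i)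
    have "of_nat i \<cdot>\<^sub>m B + B = of_nat (Suc i) \<cdot>\<^sub>m B"
      using B by (intro eq_matI) (auto simp: algebra_simps)
    then show ?case
      using Suc B by (simp add: unipotent_block_mult xB del: of_nat_Suc)
  qed
  then have "?U (of_nat j \<cdot>\<^sub>m B) = ?U (0\<^sub>m n m)"
    using eq by simp
  then have "of_nat j \<cdot>\<^sub>m B = 0\<^sub>m n m"
    by (rule four_block_mat_inject(2)[of _ _ _ _ _ _ _ _ n n m m]) (use B in auto)
  then have "(of_nat j \<cdot>\<^sub>m B) $$ (r, s) = 0" if "r < n" "s < m" for r s
    using that by simp
  then have "B = 0\<^sub>m n m"
    using B j by (intro eq_matI) auto
  then show "x = \<one>\<^bsub>?K\<^esub>"
    by (simp add: xB)
qed

lemma power_subgroup_ext_kernel: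
  assumes \<rho>: "power_subgroup k \<subseteq> kernel F2 (GL n) \<rho>" and \<sigma>: "\<And>i. i < m \<Longrightarrow> \<sigma> i \<in> lifts_k k n \<rho>"
  shows "power_subgroup k \<subseteq> kernel F2 (GL (n + m)) ext"
proof
  fix g assume g: "g \<in> power_subgroup k"
  have "fst (\<sigma> i g) = 0\<^sub>v n" if "i < m" for i
    using \<sigma>[OF that] g by (auto simp: lifts_k_def kernel_def)
  then have "Q g = 0\<^sub>m n m"
    by (intro eq_matI) auto
  then show "g \<in> kernel F2 (GL (n + m)) ext"
    using \<rho> g unfolding ext_kernel_iff by (auto simp: kernel_def)
qed

text \<open>Let \<open>f\<close> be an involutive field automorphism; the identity and complex conjugation are the ones
  that matter. The hypothesis on \<open>Q\<close> says that the twist by \<open>(M, \<phi>)\<close> maps the \<open>j\<close>-th lift to the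
  linear combination with coefficients in the \<open>j\<close>-th column of \<open>C\<close>, up to the coboundary of the
  \<open>j\<close>-th column of \<open>V\<close>. It is precisely the upper right block of the intertwining equation for
  \<open>M'\<close>, so only the invertibility of \<open>C\<close> needs an argument: if \<open>C c = 0\<close>, then the twist maps the
  combination with coefficients \<open>f c\<close> to a coboundary, and undoing the twist shows that this
  combination is itself a coboundary, so that \<open>c = 0\<close> by independence.\<close>

lemma block_intertwiner:
  assumes f: "comm_ring_hom f" and invol: "\<And>z. f (f z) = z"
    and M: "M \<in> carrier (GL n)"
    and surj: "surj \<phi>"
    and MR: "\<And>g. M * map_mat f (\<rho> (\<phi> g)) = \<rho> g * M"
    and C: "C \<in> carrier_mat m m" and V: "V \<in> carrier_mat n m"
    and MQ: "\<And>g. M * map_mat f (Q (\<phi> g)) = Q g * C + (V - \<rho> g * V)"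
    and indep: "\<And>c w. c \<in> carrier_vec m \<Longrightarrow> w \<in> carrier_vec n \<Longrightarrow>
      (\<And>g. Q g *\<^sub>v c = w - \<rho> g *\<^sub>v w) \<Longrightarrow> c = 0\<^sub>v m"
  defines "M' \<equiv> four_block_mat M (- V) (0\<^sub>m m n) C"
  shows "M' \<in> carrier (GL (n + m))" "M' * map_mat f (ext (\<phi> g)) = ext g * M'"
proof -
  interpret f: comm_ring_hom f by (rule f)
  have Mm: "M \<in> carrier_mat n n" by (rule GL_mat[OF M])
  note Mi = GL_inverse[OF M]
  have "det C \<noteq> 0"
  proof
    assume "det C = 0"
    then obtain c where c: "c \<in> carrier_vec m" and c0: "c \<noteq> 0\<^sub>v m" and Cc: "C *\<^sub>v c = 0\<^sub>v m"
      using det_0_iff_vec_prod_zero_field[OF C] by blast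
    \<comment> \<open>Since \<open>M\<close> intertwines \<open>f \<circ> \<rho> \<circ> \<phi>\<close> with \<open>\<rho>\<close>, applying \<open>M\<inverse>\<close> to the coboundary of \<open>V c\<close> gives
      the coboundary of \<open>w\<close> for \<open>f \<circ> \<rho> \<circ> \<phi>\<close>.\<close>
    define w where "w = inv\<^bsub>GL n\<^esub> M *\<^sub>v (V *\<^sub>v c)"
    have Vc: "V *\<^sub>v c \<in> carrier_vec n"
      using V c by simp
    have w: "w \<in> carrier_vec n"
      unfolding w_def using Mi(1) Vc by simp
    have Mw: "M *\<^sub>v w = V *\<^sub>v c"
      unfolding w_def using assoc_mult_mat_vec[OF Mm Mi(1) Vc] Mi(2) Vc by simp
    have twisted: "map_mat f (Q (\<phi> g)) *\<^sub>v c = w - map_mat f (\<rho> (\<phi> g)) *\<^sub>v w" for g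
    proof -
      have Rm: "map_mat f (\<rho> (\<phi> g)) \<in> carrier_mat n n" and Qm: "map_mat f (Q (\<phi> g)) \<in> carrier_mat n m"
        by simp_all
      have RV: "\<rho> g * V \<in> carrier_mat n m" and QC: "Q g * C \<in> carrier_mat n m"
        using V C by (auto intro: mult_carrier_mat[OF rep_mat] mult_carrier_mat[OF translation_mat_carrier])
      have Qc: "map_mat f (Q (\<phi> g)) *\<^sub>v c \<in> carrier_vec n" and Rw: "map_mat f (\<rho> (\<phi> g)) *\<^sub>v w \<in> carrier_vec n"
        using mult_mat_vec_carrier[OF Qm c] mult_mat_vec_carrier[OF Rm w] by auto
      have "M *\<^sub>v (map_mat f (Q (\<phi> g)) *\<^sub>v c) = (Q g * C + (V - \<rho> g * V)) *\<^sub>v c"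
        using assoc_mult_mat_vec[OF Mm Qm c] MQ by simp
      also have "\<dots> = Q g *\<^sub>v (C *\<^sub>v c) + (V *\<^sub>v c - \<rho> g *\<^sub>v (V *\<^sub>v c))"
        using add_mult_distrib_mat_vec[OF QC minus_carrier_mat[OF RV] c]
          minus_mult_distrib_mat_vec[OF V RV c]
          assoc_mult_mat_vec[OF translation_mat_carrier C c] assoc_mult_mat_vec[OF rep_mat V c]
        by simp
      also have "\<dots> = V *\<^sub>v c - \<rho> g *\<^sub>v (V *\<^sub>v c)"
        using Vc by (intro eq_vecI) (auto simp: Cc)
      also have "\<dots> = M *\<^sub>v w - M *\<^sub>v (map_mat f (\<rho> (\<phi> g)) *\<^sub>v w)"
        using assoc_mult_mat_vec[OF Mm Rm w] assoc_mult_mat_vec[OF rep_mat Mm w] MR by (simp add: Mw)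
      also have "\<dots> = M *\<^sub>v (w - map_mat f (\<rho> (\<phi> g)) *\<^sub>v w)"
        using mult_minus_distrib_mat_vec[OF Mm w Rw] by simp
      finally have "inv\<^bsub>GL n\<^esub> M *\<^sub>v (M *\<^sub>v (map_mat f (Q (\<phi> g)) *\<^sub>v c)) =
          inv\<^bsub>GL n\<^esub> M *\<^sub>v (M *\<^sub>v (w - map_mat f (\<rho> (\<phi> g)) *\<^sub>v w))"
        by simp
      then show ?thesis
        using assoc_mult_mat_vec[OF Mi(1) Mm] Mi(3) Qc minus_carrier_vec[OF w Rw] by simp
    qed
    have "Q h *\<^sub>v map_vec f c = map_vec f w - \<rho> h *\<^sub>v map_vec f w" for h
    proof -
      obtain g where h: "h = \<phi> g" using surj by auto
      have inv_mat: "map_mat f (map_mat f A) = A" for A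
        by (intro eq_matI) (auto simp: invol)
      have "Q h *\<^sub>v map_vec f c = map_vec f (map_mat f (Q h) *\<^sub>v c)"
        using f.mult_mat_vec_hom[of "map_mat f (Q h)" n m c] c by (simp add: inv_mat)
      also have "\<dots> = map_vec f (w - map_mat f (\<rho> h) *\<^sub>v w)"
        by (simp add: twisted h)
      also have "\<dots> = map_vec f w - map_vec f (map_mat f (\<rho> h) *\<^sub>v w)"
        using w by (intro eq_vecI) (auto simp: f.hom_minus)
      also have "\<dots> = map_vec f w - \<rho> h *\<^sub>v map_vec f w"
        using f.mult_mat_vec_hom[of "map_mat f (\<rho> h)" n n w] w by (simp add: inv_mat)
      finally show ?thesis .
    qed
    then have "map_vec f c = 0\<^sub>v m"
      using c w by (intro indep[of _ "map_vec f w"]) auto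
    then have "map_vec f (map_vec f c) = map_vec f (0\<^sub>v m)" by simp
    moreover have "map_vec f (map_vec f c) = c"
      by (intro eq_vecI) (auto simp: invol)
    ultimately show False
      using c0 f.vec_hom_zero by simp
  qed
  moreover have "det M' = det M * det C"
    unfolding M'_def using V by (intro det_four_block_mat_lower_left_zero[OF Mm _ HOL.refl C]) auto
  moreover have "M' \<in> carrier_mat (n + m) (n + m)"
    unfolding M'_def by (rule four_block_carrier_mat[OF Mm C])
  ultimately show "M' \<in> carrier (GL (n + m))"
    using M by (simp add: carrier_GL)
  have RV: "\<rho> g * V \<in> carrier_mat n m" and QC: "Q g * C \<in> carrier_mat n m"
    using V C by (auto intro: mult_carrier_mat[OF rep_mat] mult_carrier_mat[OF translation_mat_carrier])
  have RM: "\<rho> g * M \<in> carrier_mat n n"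
    using Mm by (rule mult_carrier_mat[OF rep_mat])
  have "map_mat f (ext (\<phi> g)) =
      four_block_mat (map_mat f (\<rho> (\<phi> g))) (map_mat f (Q (\<phi> g))) (map_mat f (0\<^sub>m m n)) (map_mat f (1\<^sub>m m))"
    unfolding ext_block by (rule map_four_block_mat[of _ n n _ m _ m]) auto
  also have "map_mat f (0\<^sub>m m n) = 0\<^sub>m m n"
    by (intro eq_matI) auto
  finally have fext: "map_mat f (ext (\<phi> g)) =
      four_block_mat (map_mat f (\<rho> (\<phi> g))) (map_mat f (Q (\<phi> g))) (0\<^sub>m m n) (1\<^sub>m m)"
    by (simp add: f.mat_hom_one)
  have "M' * map_mat f (ext (\<phi> g)) = four_block_mat
      (M * map_mat f (\<rho> (\<phi> g)) + (- V) * 0\<^sub>m m n) (M * map_mat f (Q (\<phi> g)) + (- V) * 1\<^sub>m m)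
      (0\<^sub>m m n * map_mat f (\<rho> (\<phi> g)) + C * 0\<^sub>m m n) (0\<^sub>m m n * map_mat f (Q (\<phi> g)) + C * 1\<^sub>m m)"
    unfolding M'_def fext using Mm V C
    by (intro mult_four_block_mat[of _ n n _ m _ m _ _ n _ m]) auto
  also have "\<dots> = four_block_mat (\<rho> g * M + Q g * 0\<^sub>m m n) (\<rho> g * (- V) + Q g * C)
      (0\<^sub>m m n * M + 1\<^sub>m m * 0\<^sub>m m n) (0\<^sub>m m n * (- V) + 1\<^sub>m m * C)"
  proof (rule cong_four_block_mat)
    show "M * map_mat f (\<rho> (\<phi> g)) + (- V) * 0\<^sub>m m n = \<rho> g * M + Q g * 0\<^sub>m m n"
      using V RM by (simp add: MR right_mult_zero_mat[of _ n m])
    have "A + (V - B) + - V = - B + A" if "A \<in> carrier_mat n m" "B \<in> carrier_mat n m" for A B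
      using that V by (intro eq_matI) auto
    from this[OF QC RV]
 show "M * map_mat f (Q (\<phi> g)) + (- V) * 1\<^sub>m m = \<rho> g * (- V) + Q g * C"
      using V by (simp add: MQ right_mult_one_mat[of _ n m])
    show "0\<^sub>m m n * map_mat f (\<rho> (\<phi> g)) + C * 0\<^sub>m m n = 0\<^sub>m m n * M + 1\<^sub>m m * 0\<^sub>m m n"
      using C Mm by (simp add: left_mult_zero_mat[of _ n n] right_mult_zero_mat[of _ m m])
    show "0\<^sub>m m n * map_mat f (Q (\<phi> g)) + C * 1\<^sub>m m = 0\<^sub>m m n * (- V) + 1\<^sub>m m * C"
      using C V by (simp add: left_mult_zero_mat[of _ n m] del: uminus_mult_right_mat)
  qed
  also have "\<dots> = ext g * M'"
    unfolding M'_def ext_block using Mm V C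
    by (intro mult_four_block_mat[of _ n n _ m _ m _ _ n _ m, symmetric]) auto
  finally show "M' * map_mat f (ext (\<phi> g)) = ext g * M'" .
qed

text \<open>Here the invariance of \<open>W\<close> produces the matrices \<open>C\<close> and \<open>V\<close>, one column for each lift. The map
  \<open>T\<close> stands for \<open>N_plus n M \<psi>\<close> if \<open>f\<close> is the identity and for \<open>N_minus n M \<psi>\<close> if \<open>f\<close> is complex
  conjugation.\<close>

lemma extended_rep_twisted:
  assumes f: "comm_ring_hom f" and invol: "\<And>z. f (f z) = z"
    and M: "M \<in> carrier (GL n)" and \<psi>: "\<psi> \<in> auto F2"
    and conj: "\<And>g. M * map_mat f (\<rho> (inv_into UNIV \<psi> g)) * inv\<^bsub>GL n\<^esub> M = \<rho> g"
    and T: "\<And>\<tau> g. \<tau> \<in> lifts n \<rho> \<Longrightarrow> T \<tau> g = (M *\<^sub>v map_vec f (fst (\<tau> (inv_into UNIV \<psi> g))), \<rho> g)"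
    and inv: "induced n \<rho> T ` W \<subseteq> W"
    and sub: "subspace class_ring W (lift_quotient_k k n \<rho>)"
    and inj: "inj_on (\<lambda>i. lift_class n \<rho> (\<sigma> i)) {..<m}"
    and basis: "vectorspace.basis class_ring ((lift_quotient_k k n \<rho>)\<lparr>carrier := W\<rparr>)
      ((\<lambda>i. lift_class n \<rho> (\<sigma> i)) ` {..<m})"
  shows "\<exists>M' \<in> carrier (GL (n + m)). \<forall>g.
    M' * map_mat f (ext (inv_into UNIV \<psi> g)) * inv\<^bsub>GL (n + m)\<^esub> M' = ext g"
proof -
  interpret f: comm_ring_hom f by (rule f)
  note span = lift_classes_span[OF sub inj basis] and indep = lift_classes_indep[OF sub inj basis]
    and mem = lift_class_mem[OF sub inj basis]
  note \<psi>_inv = auto_F2_inverse[OF \<psi>]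
  define \<phi> where "\<phi> = inv_into UNIV \<psi>"
  have Mm: "M \<in> carrier_mat n n" by (rule GL_mat[OF M])
  have MR: "M * map_mat f (\<rho> (\<phi> g)) = \<rho> g * M" for g
    using conj[of g] GL_conj_eq_iff[OF M, of "map_mat f (\<rho> (\<phi> g))" "\<rho> g"] by (simp add: \<phi>_def)
  have T_lift: "T \<tau> \<in> lifts n \<rho>" if \<tau>: "\<tau> \<in> lifts n \<rho>" for \<tau>
  proof -
    have "M *\<^sub>v map_vec f (fst (\<tau> (\<phi> (g \<otimes>\<^bsub>F2\<^esub> h)))) =
        M *\<^sub>v map_vec f (fst (\<tau> (\<phi> g))) + \<rho> g *\<^sub>v (M *\<^sub>v map_vec f (fst (\<tau> (\<phi> h))))" for g h
    proof -
      have u: "map_vec f (fst (\<tau> (\<phi> g))) \<in> carrier_vec n" "map_vec f (fst (\<tau> (\<phi> h))) \<in> carrier_vec n"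
        using \<tau> by simp_all
      have Rm: "map_mat f (\<rho> (\<phi> g)) \<in> carrier_mat n n" by simp
      have "map_vec f (fst (\<tau> (\<phi> (g \<otimes>\<^bsub>F2\<^esub> h)))) =
          map_vec f (fst (\<tau> (\<phi> g)) + \<rho> (\<phi> g) *\<^sub>v fst (\<tau> (\<phi> h)))"
        using \<tau> by (simp add: \<phi>_def \<psi>_inv(1) lift_fst_mult)
      also have "\<dots> = map_vec f (fst (\<tau> (\<phi> g))) + map_mat f (\<rho> (\<phi> g)) *\<^sub>v map_vec f (fst (\<tau> (\<phi> h)))"
        using \<tau> f.mult_mat_vec_hom[OF rep_mat lift_fst[OF \<tau>], of "\<phi> g" "\<phi> h", symmetric]
        by (simp, intro eq_vecI) (auto simp: f.hom_add)
      finally show ?thesis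
        using mult_add_distrib_mat_vec[OF Mm u(1) mult_mat_vec_carrier[OF Rm u(2)]]
          assoc_mult_mat_vec[OF Mm Rm u(2)] assoc_mult_mat_vec[OF rep_mat Mm u(2)] MR
        by simp
    qed
    then show ?thesis
      using T[OF \<tau>] \<tau> mult_mat_vec_carrier[OF Mm] by (simp add: lifts_iff crossed_hom_def \<phi>_def)
  qed
  have "\<exists>c v. c \<in> carrier_vec m \<and> v \<in> carrier_vec n \<and>
      (\<forall>g. M *\<^sub>v map_vec f (fst (\<sigma> j (\<phi> g))) = Q g *\<^sub>v c + (v - \<rho> g *\<^sub>v v))" if j: "j < m" for j
  proof -
    have Tj: "T (\<sigma> j) \<in> lifts n \<rho>" by (rule T_lift[OF lift[OF j]])
    have "induced n \<rho> T (lift_class n \<rho> (\<sigma> j)) \<in> W"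
      using inv mem[OF j] by auto
    then obtain c where c: "c \<in> carrier_vec m"
      and eq: "induced n \<rho> T (lift_class n \<rho> (\<sigma> j)) = lift_class n \<rho> (lift_comb n \<rho> m \<sigma> c)"
      using span by blast
    \<comment> \<open>The set \<open>induced n \<rho> T X\<close> is a union of classes, one of which contains \<open>T (\<sigma> j)\<close>; being an
      element of \<open>W\<close>, it is a single class, hence the class of \<open>T (\<sigma> j)\<close>.\<close>
    have "T (\<sigma> j) \<in> induced n \<rho> T (lift_class n \<rho> (\<sigma> j))"
      unfolding induced_def using lift_class_self[OF lift[OF j]] lift_class_self[OF Tj] by auto
    then have "T (\<sigma> j) \<in> lift_class n \<rho> (lift_comb n \<rho> m \<sigma> c)"
      by (simp add: eq)
    then have "lift_class n \<rho> (lift_comb n \<rho> m \<sigma> c) = lift_class n \<rho> (T (\<sigma> j))"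
      using mem_lift_class_iff[OF lift_comb_lift[OF c]] by simp
    then obtain v where "v \<in> carrier_vec n"
      and "\<And>g. fst (T (\<sigma> j) g) = fst (lift_comb n \<rho> m \<sigma> c g) + (v - \<rho> g *\<^sub>v v)"
      using lift_class_eq_iff[OF lift_comb_lift[OF c] Tj] by auto
    then show ?thesis
      using c T[OF lift[OF j]] by (auto simp: lift_comb_def \<phi>_def)
  qed
  then obtain c v where c: "\<And>j. j < m \<Longrightarrow> c j \<in> carrier_vec m" and v: "\<And>j. j < m \<Longrightarrow> v j \<in> carrier_vec n"
    and eq: "\<And>j g. j < m \<Longrightarrow> M *\<^sub>v map_vec f (fst (\<sigma> j (\<phi> g))) = Q g *\<^sub>v c j + (v j - \<rho> g *\<^sub>v v j)"
    by metis
  define C where "C = mat_of_cols m (map c [0..<m])"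
  define V where "V = mat_of_cols n (map v [0..<m])"
  have C: "C \<in> carrier_mat m m" and V: "V \<in> carrier_mat n m"
    by (simp_all add: C_def V_def mat_of_cols_def)
  have colC: "col C j = c j" and colV: "col V j = v j" if "j < m" for j
    using that c v by (simp_all add: C_def V_def)
  have MQ: "M * map_mat f (Q (\<phi> g)) = Q g * C + (V - \<rho> g * V)" for g
  proof (rule eq_matI)
    fix i j assume "i < dim_row (Q g * C + (V - \<rho> g * V))" "j < dim_col (Q g * C + (V - \<rho> g * V))"
    then have i: "i < n" and j: "j < m"
      using C V by auto
    have "(M * map_mat f (Q (\<phi> g))) $$ (i, j) = (M *\<^sub>v map_vec f (fst (\<sigma> j (\<phi> g)))) $ i"
      using i j Mm by (simp add: col_Q)
    also have "\<dots> = (Q g *\<^sub>v c j + (v j - \<rho> g *\<^sub>v v j)) $ i"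
      by (simp add: eq[OF j])
    also have "\<dots> = (Q g * C + (V - \<rho> g * V)) $$ (i, j)"
      using i j C V v[OF j] colV[OF j, symmetric] by (simp add: colC)
    finally show "(M * map_mat f (Q (\<phi> g))) $$ (i, j) = (Q g * C + (V - \<rho> g * V)) $$ (i, j)" .
  qed (use Mm C V in auto)
  let ?M = "four_block_mat M (- V) (0\<^sub>m m n) C"
  have GL': "?M \<in> carrier (GL (n + m))" and "\<And>g. ?M * map_mat f (ext (\<phi> g)) = ext g * ?M"
    by (rule block_intertwiner[OF f invol M \<psi>_inv(2)[folded \<phi>_def] MR C V MQ indep]; assumption)+
  then have "?M * map_mat f (ext (\<phi> g)) * inv\<^bsub>GL (n + m)\<^esub> ?M = ext g" for g
    using GL_conj_eq_iff[OF GL' map_carrier_mat[THEN iffD2, OF ext_mat] ext_mat] by blast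
  then show ?thesis
    unfolding \<phi>_def by (intro bexI[OF _ GL']) blast
qed

end

section \<open>Extension by an invariant space of lifts\<close>

lemma aff_linear_conj:
  assumes M: "M \<in> carrier (GL n)" and u: "u \<in> carrier_vec n" and A: "A \<in> carrier_mat n n"
  shows "aff_linear n M \<otimes>\<^bsub>Aff n\<^esub> (u, A) \<otimes>\<^bsub>Aff n\<^esub> aff_linear n (inv\<^bsub>GL n\<^esub> M) =
    (M *\<^sub>v u, M * A * inv\<^bsub>GL n\<^esub> M)"
proof -
  have "M *\<^sub>v u + M * A *\<^sub>v 0\<^sub>v n = M *\<^sub>v u"
    using GL_mat[OF M] u A by (intro eq_vecI) (auto simp: scalar_prod_def)
  then show ?thesis
    using GL_mat[OF M] u by (simp add: aff_linear_def)
qed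

theorem theorem3p16:
  fixes k n m :: nat
    and \<rho> :: "f2 \<Rightarrow> complex mat"
    and I :: "(f2 \<Rightarrow> aff) set set"
    and \<sigma> :: "nat \<Rightarrow> f2 \<Rightarrow> aff"
  assumes "k \<ge> 2"
    and "oriented_char_rep n \<rho>"
    and "power_subgroup k \<subseteq> kernel F2 (GL n) \<rho>"
    and "subspace class_ring I (lift_quotient_k k n \<rho>)"
    and "Delta_invariant n \<rho> I"
    and "m = vectorspace.dim class_ring ((lift_quotient_k k n \<rho>)\<lparr>carrier := I\<rparr>)"
    and "\<forall>i<m. \<sigma> i \<in> lifts_k k n \<rho>"
    and "inj_on (\<lambda>i. lift_class n \<rho> (\<sigma> i)) {..<m}"
    and "vectorspace.basis class_ring ((lift_quotient_k k n \<rho>)\<lparr>carrier := I\<rparr>)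
           ((\<lambda>i. lift_class n \<rho> (\<sigma> i)) ` {..<m})"
  defines "\<rho>' \<equiv> extended_rep n m \<rho> \<sigma>"
  defines "K \<equiv> (GL (n + m))\<lparr>carrier := \<rho>' ` kernel F2 (GL n) \<rho>\<rparr>"
  shows "oriented_char_rep (n + m) \<rho>' \<and>
    power_subgroup k \<subseteq> kernel F2 (GL (n + m)) \<rho>' \<and>
    (\<exists>\<iota> \<pi>. short_exact_seq K \<iota> (F2 Mod kernel F2 (GL (n + m)) \<rho>') \<pi> (F2 Mod kernel F2 (GL n) \<rho>)) \<and>
    comm_group K \<and> torsion_free K"
proof -
  interpret f2_rep n \<rho>
    using assms(2) by unfold_locales (simp add: oriented_char_rep_def)
  interpret lift_family n \<rho> m \<sigma>
    using assms(7) by unfold_locales (auto simp: lifts_k_def)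
  note twisted = extended_rep_twisted[OF _ _ _ _ _ _ _ assms(4,8,9)]
  have "\<exists>M. (M, \<psi>) \<in> Delta_plus (n + m) \<rho>'" if \<psi>: "\<psi> \<in> Aut_plus" for \<psi>
  proof -
    obtain M where M: "(M, \<psi>) \<in> Delta_plus n \<rho>"
      using assms(2) \<psi> by (auto simp: oriented_char_rep_def)
    then have GL: "M \<in> carrier (GL n)" and auto: "\<psi> \<in> auto F2"
      and conj: "\<And>g. M * \<rho> (inv_into UNIV \<psi> g) * inv\<^bsub>GL n\<^esub> M = \<rho> g"
      by (auto simp: Delta_plus_def Aut_plus_def)
    have id: "map_mat (\<lambda>z. z) A = A" "map_vec (\<lambda>z. z) u = u" for A :: "complex mat" and u :: "complex vec"
      by auto
    have hom: "comm_ring_hom (\<lambda>z :: complex. z)"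
      by unfold_locales auto
    have inv: "induced n \<rho> (N_plus n M \<psi>) ` I \<subseteq> I"
      using assms(5) M unfolding Delta_invariant_def by blast
    have T: "N_plus n M \<psi> \<tau> g = (M *\<^sub>v map_vec (\<lambda>z. z) (fst (\<tau> (inv_into UNIV \<psi> g))), \<rho> g)"
      if \<tau>: "\<tau> \<in> lifts n \<rho>" for \<tau> g
      using aff_linear_conj[OF GL lift_fst[OF \<tau>] rep_mat] lift_pair[OF \<tau>] conj
      unfolding N_plus_def id carrier_F2 by metis
    obtain M' where "M' \<in> carrier (GL (n + m))"
      and "\<And>g. M' * ext (inv_into UNIV \<psi> g) * inv\<^bsub>GL (n + m)\<^esub> M' = ext g"
      using twisted[OF hom _ GL auto _ T inv] conj unfolding id by auto
    then show ?thesis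
      using \<psi> by (auto simp: Delta_plus_def \<rho>'_def)
  qed
  moreover have "\<exists>M. (M, \<psi>) \<in> Delta_minus (n + m) \<rho>'" if \<psi>: "\<psi> \<in> Aut_minus" for \<psi>
  proof -
    obtain M where M: "(M, \<psi>) \<in> Delta_minus n \<rho>"
      using assms(2) \<psi> by (auto simp: oriented_char_rep_def)
    then have GL: "M \<in> carrier (GL n)" and auto: "\<psi> \<in> auto F2"
      and conj: "\<And>g. M * map_mat cnj (\<rho> (inv_into UNIV \<psi> g)) * inv\<^bsub>GL n\<^esub> M = \<rho> g"
      by (auto simp: Delta_minus_def Aut_minus_def)
    have hom: "comm_ring_hom cnj"
      by unfold_locales auto
    have inv: "induced n \<rho> (N_minus n M \<psi>) ` I \<subseteq> I"
      using assms(5) M unfolding Delta_invariant_def by blast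
    have T: "N_minus n M \<psi> \<tau> g = (M *\<^sub>v map_vec cnj (fst (\<tau> (inv_into UNIV \<psi> g))), \<rho> g)"
      if \<tau>: "\<tau> \<in> lifts n \<rho>" for \<tau> g
    proof -
      let ?h = "inv_into UNIV \<psi> g"
      have "aff_cnj (\<tau> ?h) = (map_vec cnj (fst (\<tau> ?h)), map_mat cnj (\<rho> ?h))"
        unfolding aff_cnj_def by (subst lift_pair[OF \<tau>]) simp
      then show ?thesis
        using aff_linear_conj[OF GL, of "map_vec cnj (fst (\<tau> ?h))" "map_mat cnj (\<rho> ?h)"] conj[of g] \<tau>
        unfolding N_minus_def carrier_F2 by simp
    qed
    obtain M' where "M' \<in> carrier (GL (n + m))"
      and "\<And>g. M' * map_mat cnj (ext (inv_into UNIV \<psi> g)) * inv\<^bsub>GL (n + m)\<^esub> M' = ext g"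
      using twisted[OF hom _ GL auto conj T inv] by auto
    then show ?thesis
      using \<psi> by (auto simp: Delta_minus_def \<rho>'_def)
  qed
  ultimately have "oriented_char_rep (n + m) \<rho>'"
    using ext_hom by (auto simp: oriented_char_rep_def \<rho>'_def)
  moreover have "power_subgroup k \<subseteq> kernel F2 (GL (n + m)) \<rho>'"
    unfolding \<rho>'_def using assms(7) by (intro power_subgroup_ext_kernel[OF assms(3)]) auto
  moreover have "\<exists>\<iota> \<pi>. short_exact_seq K \<iota> (F2 Mod kernel F2 (GL (n + m)) \<rho>') \<pi> (F2 Mod kernel F2 (GL n) \<rho>)"
  proof -
    have "kernel F2 (GL (n + m)) \<rho>' \<subseteq> kernel F2 (GL n) \<rho>"
      unfolding \<rho>'_def by (auto simp: ext_kernel_iff kernel_def[of F2 "GL n"])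
    moreover have "group_hom F2 (GL (n + m)) \<rho>'" "group_hom F2 (GL n) \<rho>"
      unfolding \<rho>'_def
      by (intro group_hom.intro group_hom_axioms.intro group_F2 group_GL ext_hom hom)+
    ultimately show ?thesis
      unfolding K_def
      by (intro group_hom.short_exact_seq_image_Mod_kernel group_hom.normal_kernel)
  qed
  ultimately show ?thesis
    unfolding K_def \<rho>'_def
    using comm_group_ext_image_kernel torsion_free_ext_image_kernel by blast
qed

end
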